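(* Let $d\geq 1$ and let $A\subseteq\mathbb{Z}^d$ be a finite set with $\mathrm{span}_{\mathbb{R}}(A)=\mathbb{R}^d$ and $0\in\mathrm{ex}(\mathcal{H}(A))$. Let $t\geq 1$ be an integer. For each $b\in\mathrm{ex}(\mathcal{H}(A))$ fix any admissible unit vector $\mathfrak{n}_b$ for the set $b-A$, and let $\delta_{b-A}$, $\Delta_{b-A}$ be the constants defined with respect to $\mathfrak{n}_b$. Then for every integer $$h\geq \max_{\substack{0\in B\subseteq \mathrm{ex}(\mathcal{H}(A))\\ |B|=d+1\\ \mathrm{span}_{\mathbb{R}}(B)=\mathbb{R}^d}}\ \Bigg(\sum_{b\in B}\left\lceil \frac{\Delta_{b-A}}{\delta_{b-A}}\,\varphi_{b-A,t}\right\rceil\Bigg)$$ one has $$(hA)^{(t)}=\big(h\mathcal{H}(A)\cap\Lambda_A\big)\setminus\Bigg(\bigcup_{v\in\mathrm{ex}(\mathcal{H}(A))}\big(hv-\mathcal{E}_t(v-A)\big)\Bigg).$$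
   Context: Let $A\subseteq\mathbb{Z}^d$ be finite with $\mathrm{span}_{\mathbb{R}}(A)=\mathbb{R}^d$. Its convex hull is $\mathcal{H}(A):=\{\sum_{a\in A}c_a a : c_a\in\mathbb{R}_{\geq 0},\ \sum_{a\in A} c_a=1\}$, and its set of extremal points $\mathrm{ex}(\mathcal{H}(A))$ consists of those $v\in\mathcal{H}(A)$ for which there are $\mathfrak{n}\in\mathbb{Z}^d$ and $c\in\mathbb{R}$ with $\langle\mathfrak{n},v\rangle=c$ and $\langle\mathfrak{n},x\rangle>c$ for all $x\in\mathcal{H}(A)\setminus\{v\}$ (so $\mathrm{ex}(\mathcal{H}(A))\subseteq A$). Assume $0\in\mathrm{ex}(\mathcal{H}(A))$. Let $\mathcal{C}_A:=\{\sum_{a\in A}c_a a : c_a\in\mathbb{R}_{\geq 0}\}$ and $\Lambda_A:=\{\sum_{a\in A}c_a a : c_a\in\mathbb{Z}\}$. For integers $h,t\geq 1$, let $r_{A,h}(p)$ be the number of $(k_a)_{a\in A}\in\mathbb{Z}_{\geq 0}^{A}$ with $\sum_{a\in A}k_a a=p$ and $\sum_{a\in A} k_a=h$; $(hA)^{(t)}:=\{p\in\mathbb{Z}^d : r_{A,h}(p)\geq t\}$; $\mathcal{P}_t(A):=\bigcup_{h\geq 1}(hA)^{(t)}$; $\mathcal{E}_t(A):=(\mathcal{C}_A\cap\Lambda_A)\setminus\mathcal{P}_t(A)$. For real $\lambda\ge 0$, $\lambda X=\{\lambda x:x\in X\}$; $X+Y=\{x+y\}$; $v-X=\{v-x:x\in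 X\}$. A unit vector $\mathfrak{n}\in\mathbb{R}^d$ is called admissible for $A$ if $\langle\mathfrak{n},v\rangle>0$ for every $v\in\mathcal{C}_A\setminus\{0\}$; with respect to such $\mathfrak n$, $\delta_A:=\min_{a\in A\setminus\{0\}}\langle a,\mathfrak{n}\rangle$ and $\Delta_A:=\max_{a\in A\setminus\{0\}}\langle a,\mathfrak{n}\rangle$. $\varphi_{A,t}$ denotes the minimum $\varphi\in\mathbb{R}_{\geq 1}$ such that for every real $\lambda\geq\varphi$, $\big((\lambda\mathcal{H}(A)\cap\Lambda_A)\setminus\mathcal{E}_t(A)\big)+A=\big((\lambda+1)\mathcal{H}(A)\cap\Lambda_A\big)\setminus\mathcal{E}_t(A)$ (such a minimum exists). All these definitions are also applied to the sets $v-A$ with $v\in\mathrm{ex}(\mathcal{H}(A))$, which satisfy the same assumptions. *)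

theory Defs
  imports "HOL-Analysis.Analysis" "HOL-Library.Set_Algebras"
begin

definition int_lattice :: "(real ^ 'd) set" where
  "int_lattice = {x. \<forall>i. x $ i \<in> \<int>}"

text \<open>The extremal points of \<open>\<H>(A) = convex hull A\<close>: those cut out by a supporting
  hyperplane with integer normal.\<close>

definition ex_points :: "(real ^ 'd) set \<Rightarrow> (real ^ 'd) set" where
  "ex_points A = {v \<in> convex hull A. \<exists>n \<in> int_lattice. \<exists>c::real.
     n \<bullet> v = c \<and> (\<forall>x \<in> convex hull A - {v}. n \<bullet> x > c)}"

definition cone_of :: "(real ^ 'd) set \<Rightarrow> (real ^ 'd) set" where
  "cone_of A = {\<Sum>a\<in>A. c a *\<^sub>R a | c. \<forall>a\<in>A. (0::real) \<le> c a}"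

definition lattice_of :: "(real ^ 'd) set \<Rightarrow> (real ^ 'd) set" where
  "lattice_of A = {\<Sum>a\<in>A. real_of_int (c a) *\<^sub>R a | c. True}"

text \<open>Families indexed by \<open>A\<close> are extensional functions, so that each is counted once;
  for finite \<open>A\<close> the counted set is finite because the entries sum to \<open>h\<close>.\<close>

definition rep_count :: "(real ^ 'd) set \<Rightarrow> nat \<Rightarrow> real ^ 'd \<Rightarrow> nat" where
  "rep_count A h p = card {k \<in> A \<rightarrow>\<^sub>E (UNIV :: nat set).
     (\<Sum>a\<in>A. real (k a) *\<^sub>R a) = p \<and> (\<Sum>a\<in>A. k a) = h}"

text \<open>\<open>hfold t h A\<close> is \<open>(hA)\<^sup>(\<^sup>t\<^sup>)\<close>; below, \<open>pop_set t A\<close> is \<open>\<P>\<^sub>t(A)\<close> and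
  \<open>exc_set t A\<close> is \<open>\<E>\<^sub>t(A)\<close>.\<close>

definition hfold :: "nat \<Rightarrow> nat \<Rightarrow> (real ^ 'd) set \<Rightarrow> (real ^ 'd) set" where
  "hfold t h A = {p \<in> int_lattice. rep_count A h p \<ge> t}"

definition pop_set :: "nat \<Rightarrow> (real ^ 'd) set \<Rightarrow> (real ^ 'd) set" where
  "pop_set t A = (\<Union>h\<in>{1..}. hfold t h A)"

definition exc_set :: "nat \<Rightarrow> (real ^ 'd) set \<Rightarrow> (real ^ 'd) set" where
  "exc_set t A = (cone_of A \<inter> lattice_of A) - pop_set t A"

definition reflect :: "real ^ 'd \<Rightarrow> (real ^ 'd) set \<Rightarrow> (real ^ 'd) set" where
  "reflect v X = (\<lambda>x. v - x) ` X"

definition admissible :: "(real ^ 'd) set \<Rightarrow> real ^ 'd \<Rightarrow> bool" where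
  "admissible A n \<longleftrightarrow> norm n = 1 \<and> (\<forall>v \<in> cone_of A - {0}. n \<bullet> v > 0)"

definition delta_min :: "(real ^ 'd) set \<Rightarrow> real ^ 'd \<Rightarrow> real" where
  "delta_min A n = Min ((\<lambda>a. a \<bullet> n) ` (A - {0}))"

definition delta_max :: "(real ^ 'd) set \<Rightarrow> real ^ 'd \<Rightarrow> real" where
  "delta_max A n = Max ((\<lambda>a. a \<bullet> n) ` (A - {0}))"

text \<open>Here \<open>+ A\<close> is the sumset of \<open>Set_Algebras\<close>. \<open>phi\<close> is meaningful only if the minimum
  exists; it does when \<open>A\<close> is a finite spanning set of integer vectors with \<open>0\<close> extremal.\<close>

definition phi :: "(real ^ 'd) set \<Rightarrow> nat \<Rightarrow> real" where
  "phi A t = (LEAST \<phi>::real. \<phi> \<ge> 1 \<and> (\<forall>\<mu>\<ge>\<phi>.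
     (((*\<^sub>R) \<mu> ` (convex hull A) \<inter> lattice_of A) - exc_set t A) + A
       = ((*\<^sub>R) (\<mu> + 1) ` (convex hull A) \<inter> lattice_of A) - exc_set t A))"

end

theory Submission
  imports Defs
begin

text \<open>
  Call \<open>p\<close> popular if it lies in \<open>pop_set t A\<close>, that is, if it has at least \<open>t\<close> representations of
  some common length. If \<open>p\<close> has \<open>t\<close> representations of length \<open>h\<close> over \<open>A\<close>, then for each vertex \<open>v\<close>
  the substitution \<open>a \<mapsto> v - a\<close> shows that \<open>h v - p\<close> has \<open>t\<close> representations of length \<open>h\<close> over
  \<open>v - A\<close>, hence is not exceptional there. This is the easy inclusion.

  Conversely, let \<open>p\<close> be a lattice point of the dilate by \<open>h\<close> such that every \<open>h v - p\<close> is popular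
  for \<open>v - A\<close>. Decompose \<open>p = \<Sum>c\<^sub>b b\<close> over the vertices \<open>B\<close> of a full-dimensional simplex
  containing \<open>0\<close>, with \<open>\<Sum>c\<^sub>b = h\<close> (\<open>dilation_simplex_decomposition\<close>). By the bound on \<open>h\<close> and
  pigeonhole, \<open>c\<^sub>b \<ge> (\<Delta> / \<delta>) phi\<close> for some \<open>b\<close>, where the constants are those of \<open>b - A\<close>. Then
  \<open>h b - p\<close> lies in the small dilate of the hull of \<open>b - A\<close> by \<open>h - c\<^sub>b\<close>. The defining property of
  \<open>phi\<close> allows summands to be removed one at a time, each lowering the scale by one, until the
  scale is \<open>phi\<close>. There, an admissible functional bounds the number of nonzero summands of any
  representation by \<open>(\<Delta> / \<delta>) phi \<le> c\<^sub>b\<close>, so padding with zeros gives \<open>t\<close> representations of the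
  remaining length; altogether the length is \<open>h\<close> (\<open>hfold_of_pop_set\<close>). Reflecting back gives
  \<open>p\<close> in \<open>hfold t h A\<close>.

  Two facts about the definitions carry the rest. First, \<open>phi\<close> is defined as a least element, which
  has to be shown to exist (\<open>phi_attained\<close>): suitable scales exist by a Dickson type finiteness
  argument (\<open>pop_set_coefficient_bound\<close>), and the infimum is attained because the lattice points of
  a dilate do not change when the scale increases slightly. Secondly, extremal points are cut out
  by integer normals, and they still generate the convex hull (\<open>convex_hull_ex_points\<close>), by the
  Krein--Milman theorem and rounding of normals.
\<close>

section \<open>Dilations of the convex hull\<close>

lemma dilationE:
  fixes A :: "(real ^ 'd) set"
  assumes "finite A" "p \<in> (*\<^sub>R) \<mu> ` (convex hull A)" "0 \<le> \<mu>"
  obtains c where "\<forall>a\<in>A. 0 \<le> c a" "sum c A = \<mu>" "(\<Sum>a\<in>A. c a *\<^sub>R a) = p"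
proof -
  obtain u where u: "\<forall>a\<in>A. 0 \<le> u a" "sum u A = 1" "p = \<mu> *\<^sub>R (\<Sum>a\<in>A. u a *\<^sub>R a)"
    using assms(1,2) by (auto simp: convex_hull_finite)
  show thesis
    using u assms(3)
    by (intro that[of "\<lambda>a. \<mu> * u a"]) (auto simp: scaleR_sum_right sum_distrib_left[symmetric])
qed

lemma dilationI:
  fixes A :: "(real ^ 'd) set"
  assumes "finite A" "0 \<in> A" and c: "\<forall>a\<in>A. 0 \<le> c a" "sum c A = \<mu>" "(\<Sum>a\<in>A. c a *\<^sub>R a) = p"
  shows "p \<in> (*\<^sub>R) \<mu> ` (convex hull A)"
proof (cases "\<mu> = 0")
  case True
  then have "\<forall>a\<in>A. c a = 0" using c assms(1) by (simp add: sum_nonneg_eq_0_iff)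
  then have "p = 0" using c(3) by auto
  then show ?thesis using True assms(2) by (auto intro!: image_eqI[of _ _ 0] hull_inc)
next
  case False
  moreover have "0 \<le> \<mu>" using c(1,2) by (auto intro: sum_nonneg)
  ultimately have "(\<Sum>a\<in>A. (c a / \<mu>) *\<^sub>R a) \<in> convex hull A"
    using c assms
    by (auto simp: convex_hull_finite sum_divide_distrib[symmetric] intro!: exI[of _ "\<lambda>a. c a / \<mu>"])
  moreover have "p = \<mu> *\<^sub>R (\<Sum>a\<in>A. (c a / \<mu>) *\<^sub>R a)"
    using False c(3) by (simp add: scaleR_sum_right)
  ultimately show ?thesis by blast
qed

text \<open>Since \<open>0\<close> is among the generators, its coefficient can absorb any additional mass.\<close>

lemma dilation_mono:
  fixes A :: "(real ^ 'd) set"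
  assumes "finite A" "0 \<in> A" "0 \<le> \<mu>" "\<mu> \<le> \<nu>"
  shows "(*\<^sub>R) \<mu> ` (convex hull A) \<subseteq> (*\<^sub>R) \<nu> ` (convex hull A)"
proof
  fix p assume p: "p \<in> (*\<^sub>R) \<mu> ` (convex hull A)"
  obtain c where c: "\<forall>a\<in>A. 0 \<le> c a" "sum c A = \<mu>" "(\<Sum>a\<in>A. c a *\<^sub>R a) = p"
    by (rule dilationE[OF assms(1) p assms(3)])
  let ?c = "c(0 := c 0 + (\<nu> - \<mu>))"
  have "sum ?c A = ?c 0 + sum ?c (A - {0})" using assms by (simp add: sum.remove[of A 0])
  also have "sum ?c (A - {0}) = sum c (A - {0})" by (rule sum.cong) auto
  finally have s: "sum ?c A = \<nu>" using c(2) assms by (simp add: sum.remove[of A 0])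
  have "(\<Sum>a\<in>A. ?c a *\<^sub>R a) = (\<Sum>a\<in>A. c a *\<^sub>R a)" by (rule sum.cong) auto
  with s show "p \<in> (*\<^sub>R) \<nu> ` (convex hull A)"
    using assms c by (intro dilationI[of A ?c]) auto
qed

section \<open>Integer points and generated lattices\<close>

lemma finite_bounded_int_lattice:
  assumes "bounded (X :: (real ^ 'd) set)" "X \<subseteq> int_lattice"
  shows "finite X"
proof -
  obtain M where M: "\<forall>x\<in>X. norm x \<le> M" using assms(1) by (auto simp: bounded_iff)
  let ?F = "(UNIV :: 'd set) \<rightarrow>\<^sub>E {- \<lceil>M\<rceil> .. \<lceil>M\<rceil>}"
  have "X \<subseteq> (\<lambda>f. \<chi> i. real_of_int (f i)) ` ?F"
  proof
    fix x assume x: "x \<in> X"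
    have "\<bar>x $ i\<bar> \<le> M" for i using M x component_le_norm_cart[of x i] by force
    then have M': "- M \<le> x $ i" "x $ i \<le> M" for i by (simp_all add: abs_le_iff minus_le_iff)
    have b: "- \<lceil>M\<rceil> \<le> \<lfloor>x $ i\<rfloor> \<and> \<lfloor>x $ i\<rfloor> \<le> \<lceil>M\<rceil>" for i
    proof
      show "- \<lceil>M\<rceil> \<le> \<lfloor>x $ i\<rfloor>" unfolding le_floor_iff using M'(1)[of i] le_of_int_ceiling[of M] by linarith
      show "\<lfloor>x $ i\<rfloor> \<le> \<lceil>M\<rceil>"
        using floor_mono[OF M'(2)[of i]] floor_le_ceiling[of M] by linarith
    qed
    have "x $ i \<in> \<int>" for i using assms(2) x by (auto simp: int_lattice_def)
    then have "x = (\<chi> i. real_of_int \<lfloor>x $ i\<rfloor>)"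
      by (simp add: vec_eq_iff)
    moreover have "(\<lambda>i. \<lfloor>x $ i\<rfloor>) \<in> ?F" using b by (auto simp: PiE_def)
    ultimately show "x \<in> (\<lambda>f. \<chi> i. real_of_int (f i)) ` ?F" by (rule image_eqI)
  qed
  moreover have "finite ?F" by (intro finite_PiE) auto
  ultimately show ?thesis by (meson finite_imageI finite_subset)
qed

lemma int_lattice_closed:
  "0 \<in> int_lattice"
  "x \<in> int_lattice \<Longrightarrow> y \<in> int_lattice \<Longrightarrow> x + y \<in> int_lattice"
  "x \<in> int_lattice \<Longrightarrow> y \<in> int_lattice \<Longrightarrow> x - y \<in> int_lattice"
  "x \<in> int_lattice \<Longrightarrow> real_of_int z *\<^sub>R x \<in> int_lattice"
  "x \<in> int_lattice \<Longrightarrow> real m *\<^sub>R x \<in> int_lattice"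
  by (auto simp: int_lattice_def intro: Ints_mult)

lemma int_lattice_sum:
  "(\<And>a. a \<in> A \<Longrightarrow> f a \<in> int_lattice) \<Longrightarrow> sum f A \<in> int_lattice"
  by (induction A rule: infinite_finite_induct) (auto intro: int_lattice_closed)

lemma lattice_of_closed:
  "0 \<in> lattice_of A"
  "x \<in> lattice_of A \<Longrightarrow> y \<in> lattice_of A \<Longrightarrow> x + y \<in> lattice_of A"
  "x \<in> lattice_of A \<Longrightarrow> y \<in> lattice_of A \<Longrightarrow> x - y \<in> lattice_of A"
  "x \<in> lattice_of A \<Longrightarrow> real_of_int z *\<^sub>R x \<in> lattice_of A"
proof -
  show "0 \<in> lattice_of A" unfolding lattice_of_def by (auto intro!: exI[of _ "\<lambda>_. 0"])
  show "x \<in> lattice_of A \<Longrightarrow> y \<in> lattice_of A \<Longrightarrow> x + y \<in> lattice_of A"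
    unfolding lattice_of_def
    apply (elim CollectE exE conjE)
    subgoal for c d by (auto intro!: exI[of _ "\<lambda>a. c a + d a"] simp: scaleR_left_distrib sum.distrib)
    done
  show "x \<in> lattice_of A \<Longrightarrow> y \<in> lattice_of A \<Longrightarrow> x - y \<in> lattice_of A"
    unfolding lattice_of_def
    apply (elim CollectE exE conjE)
    subgoal for c d by (auto intro!: exI[of _ "\<lambda>a. c a - d a"] simp: scaleR_left_diff_distrib sum_subtractf)
    done
  show "x \<in> lattice_of A \<Longrightarrow> real_of_int z *\<^sub>R x \<in> lattice_of A"
    unfolding lattice_of_def
    apply (elim CollectE exE conjE)
    subgoal for c by (auto intro!: exI[of _ "\<lambda>a. z * c a"] simp: scaleR_sum_right)
    done
qed

lemma lattice_of_superset:
  assumes "finite A" "a \<in> A" shows "a \<in> lattice_of A"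
proof -
  have "(\<Sum>b\<in>A. real_of_int (if b = a then 1 else 0) *\<^sub>R b) = a"
    using assms by (simp add: if_distrib[of real_of_int] if_distrib[of "\<lambda>r. r *\<^sub>R _"] cong: if_cong)
  then show ?thesis unfolding lattice_of_def
    by (intro CollectI exI[of _ "\<lambda>b. if b = a then 1 else 0"]) simp
qed

lemma lattice_of_sum:
  "(\<And>a. a \<in> B \<Longrightarrow> f a \<in> lattice_of A) \<Longrightarrow> sum f B \<in> lattice_of A"
  by (induction B rule: infinite_finite_induct) (auto intro: lattice_of_closed)

lemma lattice_of_subset_int_lattice:
  "A \<subseteq> int_lattice \<Longrightarrow> lattice_of A \<subseteq> int_lattice"
  by (auto simp: lattice_of_def intro!: int_lattice_sum int_lattice_closed)

lemma lattice_of_least: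
  assumes "finite B" "A \<subseteq> lattice_of B"
  shows "lattice_of A \<subseteq> lattice_of B"
  using assms by (auto simp: lattice_of_def[of A] intro!: lattice_of_sum lattice_of_closed)

lemma finite_reflect: "finite A \<Longrightarrow> finite (reflect v A)"
  by (simp add: reflect_def)

lemma reflect_reflect: "reflect v (reflect v A) = A"
  by (auto simp: reflect_def image_image)

text \<open>Both \<open>A\<close> and \<open>v - A\<close> contain \<open>0\<close> and \<open>v\<close>, and \<open>A = v - (v - A)\<close>, so each
  lattice contains the generators of the other.\<close>

lemma lattice_of_reflect:
  fixes A :: "(real ^ 'd) set"
  assumes "finite A" "0 \<in> A" "v \<in> A"
  shows "lattice_of (reflect v A) = lattice_of A"
proof -
  have *: "lattice_of (reflect v A) \<subseteq> lattice_of A" if "finite A" "v \<in> A" for A :: "(real ^ 'd) set"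
  proof (rule lattice_of_least[OF that(1)], rule subsetI)
    fix x assume "x \<in> reflect v A"
    then obtain a where "a \<in> A" "x = v - a" by (auto simp: reflect_def)
    then show "x \<in> lattice_of A" using that by (simp add: lattice_of_closed(3) lattice_of_superset)
  qed
  have "v \<in> reflect v A" using assms(2) by (force simp: reflect_def)
  then show ?thesis
    using *[OF assms(1,3)] *[of "reflect v A"] assms finite_reflect[of A v] by (auto simp: reflect_reflect)
qed

section \<open>Comparing numbers of representations\<close>

lemma finite_representations:
  assumes "finite A"
  shows "finite {k \<in> A \<rightarrow>\<^sub>E (UNIV :: nat set).
     (\<Sum>a\<in>A. real (k a) *\<^sub>R a) = p \<and> (\<Sum>a\<in>A. k a) = h}"
proof (rule finite_subset)
  show "{k \<in> A \<rightarrow>\<^sub>E (UNIV :: nat set). (\<Sum>a\<in>A. real (k a) *\<^sub>R a) = p \<and> (\<Sum>a\<in>A. k a) = h}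
    \<subseteq> A \<rightarrow>\<^sub>E {..h}"
  proof
    fix k assume "k \<in> {k \<in> A \<rightarrow>\<^sub>E (UNIV :: nat set). (\<Sum>a\<in>A. real (k a) *\<^sub>R a) = p \<and> (\<Sum>a\<in>A. k a) = h}"
    then show "k \<in> A \<rightarrow>\<^sub>E {..h}" using member_le_sum[of _ A k] assms by (auto simp: PiE_iff)
  qed
  show "finite (A \<rightarrow>\<^sub>E {..h})" using assms by (intro finite_PiE) auto
qed

lemma rep_count_posD:
  assumes "rep_count A h p \<ge> 1"
  obtains k where "(\<Sum>a\<in>A. real (k a) *\<^sub>R a) = p" "(\<Sum>a\<in>A. k a) = h"
proof -
  have "{k \<in> A \<rightarrow>\<^sub>E (UNIV :: nat set). (\<Sum>a\<in>A. real (k a) *\<^sub>R a) = p \<and> (\<Sum>a\<in>A. k a) = h} \<noteq> {}"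
    using assms unfolding rep_count_def by (metis card.empty not_one_le_zero)
  then show ?thesis using that by blast
qed

lemma rep_count_add_element:
  assumes "finite A" "a \<in> A"
  shows "rep_count A h p \<le> rep_count A (Suc h) (p + a)"
  unfolding rep_count_def
proof (rule card_inj_on_le[OF _ _ finite_representations[OF assms(1)]])
  let ?f = "\<lambda>k::_ \<Rightarrow> nat. k(a := Suc (k a))"
  show "inj_on ?f {k \<in> A \<rightarrow>\<^sub>E UNIV. (\<Sum>a\<in>A. real (k a) *\<^sub>R a) = p \<and> sum k A = h}"
  proof (rule inj_onI, rule ext)
    fix k l :: "_ \<Rightarrow> nat" and x assume eq: "?f k = ?f l"
    show "k x = l x" using fun_cong[OF eq, of x] by (cases "x = a") auto
  qed
  show "?f ` {k \<in> A \<rightarrow>\<^sub>E UNIV. (\<Sum>a\<in>A. real (k a) *\<^sub>R a) = p \<and> sum k A = h}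
    \<subseteq> {k \<in> A \<rightarrow>\<^sub>E UNIV. (\<Sum>a\<in>A. real (k a) *\<^sub>R a) = p + a \<and> sum k A = Suc h}"
  proof (rule image_subsetI, intro CollectI conjI)
    fix k assume k: "k \<in> {k \<in> A \<rightarrow>\<^sub>E UNIV. (\<Sum>a\<in>A. real (k a) *\<^sub>R a) = p \<and> sum k A = h}"
    show "?f k \<in> A \<rightarrow>\<^sub>E UNIV" using k assms by (auto simp: PiE_iff extensional_def)
    have "(\<Sum>b\<in>A. real (?f k b) *\<^sub>R b) = (\<Sum>b\<in>A - {a}. real (?f k b) *\<^sub>R b) + real (Suc (k a)) *\<^sub>R a"
      using assms by (simp add: sum.remove[of A a])
    also have "(\<Sum>b\<in>A - {a}. real (?f k b) *\<^sub>R b) = (\<Sum>b\<in>A - {a}. real (k b) *\<^sub>R b)"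
      by (rule sum.cong) auto
    finally show "(\<Sum>b\<in>A. real (?f k b) *\<^sub>R b) = p + a"
      using k assms by (simp add: sum.remove[of A a] algebra_simps)
    have "(\<Sum>b\<in>A. ?f k b) = (\<Sum>b\<in>A - {a}. ?f k b) + Suc (k a)"
      using assms by (simp add: sum.remove[of A a])
    also have "(\<Sum>b\<in>A - {a}. ?f k b) = sum k (A - {a})" by (rule sum.cong) auto
    finally show "sum (?f k) A = Suc h"
      using k assms by (simp add: sum.remove[of A a])
  qed
qed

text \<open>The coefficient of \<open>0\<close> does not affect the sum, so it can be reset to make the total
  coefficient \<open>m\<close>, provided that the other coefficients leave room for it. A short element
  therefore has at least as many representations of length \<open>m\<close> as of any other length.\<close>

lemma rep_count_pad_zero:
  assumes "finite A" "0 \<in> A"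
    and short: "\<And>k :: _ \<Rightarrow> nat. (\<Sum>a\<in>A. real (k a) *\<^sub>R a) = p \<Longrightarrow> sum k (A - {0}) \<le> m"
  shows "rep_count A h p \<le> rep_count A m p"
  unfolding rep_count_def
proof (rule card_inj_on_le[OF _ _ finite_representations[OF assms(1)]])
  let ?f = "\<lambda>k::_ \<Rightarrow> nat. k(0 := m - sum k (A - {0}))"
  let ?S = "{k \<in> A \<rightarrow>\<^sub>E UNIV. (\<Sum>a\<in>A. real (k a) *\<^sub>R a) = p \<and> sum k A = h}"
  show "inj_on ?f ?S"
  proof (rule inj_onI, rule ext)
    fix k l x assume k: "k \<in> ?S" and l: "l \<in> ?S" and eq: "?f k = ?f l"
    have e: "k y = l y" if "y \<noteq> 0" for y using fun_cong[OF eq, of y] that by simp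
    then have "sum k (A - {0}) = sum l (A - {0})" by (intro sum.cong) auto
    moreover have "sum k A = sum l A" using k l by simp
    ultimately have "k 0 = l 0" using assms by (simp add: sum.remove[of A 0])
    with e show "k x = l x" by metis
  qed
  show "?f ` ?S \<subseteq> {k \<in> A \<rightarrow>\<^sub>E UNIV. (\<Sum>a\<in>A. real (k a) *\<^sub>R a) = p \<and> sum k A = m}"
  proof (rule image_subsetI, intro CollectI conjI)
    fix k assume k: "k \<in> ?S"
    show "?f k \<in> A \<rightarrow>\<^sub>E UNIV" using k assms by (auto simp: PiE_iff extensional_def)
    have "(\<Sum>b\<in>A. real (?f k b) *\<^sub>R b) = (\<Sum>b\<in>A. real (k b) *\<^sub>R b)"
      by (rule sum.cong) auto
    then show "(\<Sum>b\<in>A. real (?f k b) *\<^sub>R b) = p" using k by simp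
    have "sum (?f k) A = ?f k 0 + sum (?f k) (A - {0})" using assms by (simp add: sum.remove[of A 0])
    also have "sum (?f k) (A - {0}) = sum k (A - {0})" by (rule sum.cong) auto
    finally show "sum (?f k) A = m" using short[of k] k by simp
  qed
qed

text \<open>The map \<open>k \<mapsto> (\<lambda>x. k (v - x))\<close> turns representations of \<open>p\<close> over \<open>A\<close> into representations
  of \<open>h v - p\<close> over \<open>v - A\<close>. As \<open>v - (v - A) = A\<close>, this inequality also yields its converse.\<close>

lemma rep_count_reflect_le:
  fixes A :: "(real ^ 'd) set"
  assumes "finite A"
  shows "rep_count A h p \<le> rep_count (reflect v A) h (real h *\<^sub>R v - p)"
  unfolding rep_count_def
proof (rule card_inj_on_le[OF _ _ finite_representations[OF finite_reflect[OF assms]]])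
  let ?f = "\<lambda>k::_ \<Rightarrow> nat. restrict (\<lambda>x. k (v - x)) (reflect v A)"
  let ?S = "{k \<in> A \<rightarrow>\<^sub>E UNIV. (\<Sum>a\<in>A. real (k a) *\<^sub>R a) = p \<and> sum k A = h}"
  have bij: "inj_on (\<lambda>x. v - x) A" by (auto simp: inj_on_def)
  show "inj_on ?f ?S"
  proof (rule inj_onI)
    fix k l assume k: "k \<in> ?S" and l: "l \<in> ?S" and eq: "?f k = ?f l"
    have "k a = l a" if "a \<in> A" for a using fun_cong[OF eq, of "v - a"] that by (auto simp: reflect_def)
    with k l show "k = l" by (intro PiE_ext[of k A _ l]) auto
  qed
  show "?f ` ?S \<subseteq> {k \<in> reflect v A \<rightarrow>\<^sub>E UNIV.
      (\<Sum>a\<in>reflect v A. real (k a) *\<^sub>R a) = real h *\<^sub>R v - p \<and> sum k (reflect v A) = h}"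
  proof (rule image_subsetI, intro CollectI conjI)
    fix k assume k: "k \<in> ?S"
    have s: "sum (?f k) (reflect v A) = sum k A"
      unfolding reflect_def by (subst sum.reindex[OF bij]) (auto intro!: sum.cong)
    have "(\<Sum>a\<in>reflect v A. real (?f k a) *\<^sub>R a) = (\<Sum>a\<in>A. real (k a) *\<^sub>R (v - a))"
      unfolding reflect_def by (subst sum.reindex[OF bij]) (auto intro!: sum.cong)
    also have "\<dots> = real (sum k A) *\<^sub>R v - (\<Sum>a\<in>A. real (k a) *\<^sub>R a)"
      by (simp add: scaleR_right_diff_distrib sum_subtractf scaleR_sum_left)
    also have "\<dots> = real h *\<^sub>R v - p" using k by simp
    finally show "(\<Sum>a\<in>reflect v A. real (?f k a) *\<^sub>R a) = real h *\<^sub>R v - p" .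
    show "sum (?f k) (reflect v A) = h" using s k by simp
  qed auto
qed

lemma rep_count_reflect:
  fixes A :: "(real ^ 'd) set"
  assumes "finite A"
  shows "rep_count (reflect v A) h (real h *\<^sub>R v - p) = rep_count A h p"
  using rep_count_reflect_le[OF assms, of h p v]
    rep_count_reflect_le[OF finite_reflect[OF assms], of v h "real h *\<^sub>R v - p" v]
  by (simp add: reflect_reflect)

section \<open>The sets of popular elements\<close>

lemma hfold_subset_dilation:
  fixes A :: "(real ^ 'd) set"
  assumes "finite A" "0 \<in> A" "t \<ge> 1" "p \<in> hfold t h A"
  shows "p \<in> (*\<^sub>R) (real h) ` (convex hull A)" "p \<in> lattice_of A"
proof -
  obtain k where k: "(\<Sum>a\<in>A. real (k a) *\<^sub>R a) = p" "sum k A = h"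
    using assms rep_count_posD[of A h p] by (auto simp: hfold_def)
  show "p \<in> (*\<^sub>R) (real h) ` (convex hull A)"
    using k assms(1,2) by (intro dilationI[of A "\<lambda>a. real (k a)"]) auto
  show "p \<in> lattice_of A"
    unfolding lattice_of_def using k(1) by (intro CollectI exI[of _ "\<lambda>a. int (k a)"]) simp
qed

lemma hfold_add_element:
  assumes "finite A" "A \<subseteq> int_lattice" "p \<in> hfold t h A" "a \<in> A"
  shows "p + a \<in> hfold t (Suc h) A"
  using assms rep_count_add_element[of A a h p] unfolding hfold_def
  by (auto intro: int_lattice_closed(2))

lemma pop_set_add_element:
  assumes "finite A" "A \<subseteq> int_lattice" "p \<in> pop_set t A" "a \<in> A"
  shows "p + a \<in> pop_set t A"
  using assms hfold_add_element[OF assms(1,2) _ assms(4)] unfolding pop_set_def by fastforce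

lemma pop_set_add_sum:
  assumes "finite A" "A \<subseteq> int_lattice" "p \<in> pop_set t A"
  shows "p + (\<Sum>a\<in>A. real (k a) *\<^sub>R a) \<in> pop_set t A"
proof -
  have mult: "q + real m *\<^sub>R a \<in> pop_set t A" if "a \<in> A" "q \<in> pop_set t A" for q m a
  proof (induction m)
    case (Suc m)
    then show ?case using pop_set_add_element[OF assms(1,2) Suc that(1)] by (simp add: algebra_simps)
  qed (use that in simp)
  have "p + (\<Sum>a\<in>F. real (k a) *\<^sub>R a) \<in> pop_set t A" if "finite F" "F \<subseteq> A" for F
    using that
  proof (induction F)
    case (insert x F)
    then show ?case using mult[of x "p + (\<Sum>a\<in>F. real (k a) *\<^sub>R a)" "k x"] by (simp add: algebra_simps)
  qed (use assms in simp)
  then show ?thesis using assms by blast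
qed

lemma pop_set_subset_lattice:
  fixes A :: "(real ^ 'd) set"
  assumes "finite A" "0 \<in> A" "t \<ge> 1"
  shows "pop_set t A \<subseteq> lattice_of A"
  using hfold_subset_dilation(2)[OF assms] by (auto simp: pop_set_def)

lemma dilation_subset_cone:
  fixes A :: "(real ^ 'd) set"
  assumes "finite A" "0 \<le> \<mu>"
  shows "(*\<^sub>R) \<mu> ` (convex hull A) \<subseteq> cone_of A"
proof
  fix p assume p: "p \<in> (*\<^sub>R) \<mu> ` (convex hull A)"
  obtain c where "\<forall>a\<in>A. 0 \<le> c a" "(\<Sum>a\<in>A. c a *\<^sub>R a) = p"
    by (rule dilationE[OF assms(1) p assms(2)])
  then show "p \<in> cone_of A" unfolding cone_of_def by (intro CollectI exI[of _ c]) simp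
qed

text \<open>A dilate lies in the cone, so removing the exceptional set leaves exactly the popular
  elements; the equation defining \<open>phi\<close> becomes a statement about \<open>pop_set\<close>.\<close>

lemma dilation_diff_exc_set:
  fixes A :: "(real ^ 'd) set"
  assumes "finite A" "0 \<in> A" "t \<ge> 1" "0 \<le> \<mu>"
  shows "(*\<^sub>R) \<mu> ` (convex hull A) \<inter> lattice_of A - exc_set t A
    = (*\<^sub>R) \<mu> ` (convex hull A) \<inter> pop_set t A"
  using pop_set_subset_lattice[OF assms(1-3)] dilation_subset_cone[OF assms(1,4)]
  unfolding exc_set_def by blast

section \<open>Large coefficients of popular elements\<close>

lemma nat_sequence_incseq_subsequence:
  fixes x :: "nat \<Rightarrow> nat"
  shows "\<exists>r :: nat \<Rightarrow> nat. strict_mono r \<and> incseq (\<lambda>i. x (r i))"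
proof -
  obtain r where r: "strict_mono r \<and> monoseq (\<lambda>i. x (r i))" using seq_monosub[of x] by (rule exE)
  show ?thesis
  proof (cases "incseq (\<lambda>i. x (r i))")
    case False
    then have d: "decseq (\<lambda>i. x (r i))" using r by (simp add: monoseq_iff)
    define i0 where "i0 = (ARG_MIN (\<lambda>i. x (r i)) i. True)"
    have i0: "x (r i0) \<le> x (r i)" for i
      unfolding i0_def by (rule arg_min_nat_le) simp
    have "x (r (i + i0)) = x (r i0)" for i
      using i0[of "i + i0"] decseqD[OF d, of i0 "i + i0"] by simp
    then show ?thesis
      using r by (intro exI[of _ "\<lambda>i. r (i + i0)"]) (simp add: strict_mono_def incseq_def)
  qed (use r in \<open>intro exI[of _ r], simp\<close>)
qed

text \<open>A sequential form of Dickson's lemma: tuples of naturals are well quasi-ordered.\<close>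

lemma nat_tuples_incseq_subsequence:
  fixes x :: "nat \<Rightarrow> 'a \<Rightarrow> nat"
  assumes "finite A"
  shows "\<exists>r :: nat \<Rightarrow> nat. strict_mono r \<and> (\<forall>a\<in>A. incseq (\<lambda>i. x (r i) a))"
  using assms
proof (induction A)
  case empty
  show ?case by (auto intro!: exI[of _ id] simp: strict_mono_def)
next
  case (insert a A)
  obtain r where r: "strict_mono r \<and> (\<forall>a\<in>A. incseq (\<lambda>i. x (r i) a))"
    using insert.IH by (rule exE)
  obtain s where s: "strict_mono s \<and> incseq (\<lambda>i. x (r (s i)) a)"
    using nat_sequence_incseq_subsequence[of "\<lambda>i. x (r i) a"] by (rule exE)
  have "strict_mono (r \<circ> s)" using r s by (simp add: strict_mono_o)
  moreover have "incseq (\<lambda>i. x (r (s i)) b)" if "b \<in> A" for b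
    using r that s by (auto simp: incseq_def dest: strict_mono_mono monoD)
  ultimately show ?case using s by (intro exI[of _ "r \<circ> s"]) (simp add: o_def)
qed

lemma finite_range_constant_subsequence:
  assumes "finite F" "\<And>i :: nat. f i \<in> F"
  obtains e :: "nat \<Rightarrow> nat" and y where "strict_mono e" "\<And>i. f (e i) = y"
proof -
  have "\<exists>i\<in>UNIV. infinite {j \<in> UNIV. f j = f i}"
    using assms by (intro pigeonhole_infinite) (auto intro: finite_subset)
  then obtain i where inf: "infinite {j. f j = f i}" by auto
  show thesis
    using that[of "enumerate {j. f j = f i}" "f i"] strict_mono_enumerate[OF inf] enumerate_in_set[OF inf]
    by auto
qed

text \<open>Split \<open>p = \<Sum>c\<^sub>a a\<close> into the fractional part \<open>f = \<Sum>frac c\<^sub>a a\<close> and the integer part with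
  coefficients \<open>n\<^sub>a = \<lfloor>c\<^sub>a\<rfloor>\<close>. Only finitely many \<open>f\<close> occur for popular \<open>p\<close>, because they are
  integer points in a bounded set. For each \<open>f\<close> the tuples \<open>n\<close> that give popular elements form an
  up-set of \<open>\<nat>\<^sup>A\<close>, which has finitely many minimal elements. A coordinate that exceeds those of
  all minimal elements can be lowered without leaving the up-set, which is the claim. The proof
  runs this argument on a sequence of counterexamples.\<close>

lemma pop_set_coefficient_bound:
  fixes A :: "(real ^ 'd) set"
  assumes A: "finite A" "A \<subseteq> int_lattice" "0 \<in> A" "t \<ge> 1"
  shows "\<exists>K :: nat. \<forall>c. (\<forall>a\<in>A. 0 \<le> c a) \<longrightarrow> (\<Sum>b\<in>A. c b *\<^sub>R b) \<in> pop_set t A \<longrightarrow>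
    (\<forall>a\<in>A. real K \<le> c a \<longrightarrow> (\<Sum>b\<in>A. c b *\<^sub>R b) - a \<in> pop_set t A)"
proof (rule ccontr)
  assume "\<not> ?thesis"
  then have "\<forall>K :: nat. \<exists>c a. (\<forall>a\<in>A. 0 \<le> c a) \<and> (\<Sum>b\<in>A. c b *\<^sub>R b) \<in> pop_set t A \<and>
    a \<in> A \<and> real K \<le> c a \<and> (\<Sum>b\<in>A. c b *\<^sub>R b) - a \<notin> pop_set t A" by blast
  then have "\<exists>c a. \<forall>K :: nat. (\<forall>a\<in>A. 0 \<le> c K a) \<and> (\<Sum>b\<in>A. c K b *\<^sub>R b) \<in> pop_set t A \<and>
    a K \<in> A \<and> real K \<le> c K (a K) \<and> (\<Sum>b\<in>A. c K b *\<^sub>R b) - a K \<notin> pop_set t A"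
    unfolding choice_iff .
  then obtain c a where ca: "\<And>K :: nat. (\<forall>a\<in>A. 0 \<le> c K a) \<and> (\<Sum>b\<in>A. c K b *\<^sub>R b) \<in> pop_set t A \<and>
    a K \<in> A \<and> real K \<le> c K (a K) \<and> (\<Sum>b\<in>A. c K b *\<^sub>R b) - a K \<notin> pop_set t A"
    by (elim exE) (rule that, drule spec)
  define n where "n K b = nat \<lfloor>c K b\<rfloor>" for K b
  define f where "f K = (\<Sum>b\<in>A. frac (c K b) *\<^sub>R b)" for K
  have split: "(\<Sum>b\<in>A. c K b *\<^sub>R b) = f K + (\<Sum>b\<in>A. real (n K b) *\<^sub>R b)" for K
  proof -
    have "c K b = frac (c K b) + real (n K b)" if "b \<in> A" for b
      using ca[of K] that by (simp add: n_def frac_def)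
    then have "(\<Sum>b\<in>A. c K b *\<^sub>R b) = (\<Sum>b\<in>A. (frac (c K b) + real (n K b)) *\<^sub>R b)"
      by (intro sum.cong) auto
    then show ?thesis by (simp add: f_def scaleR_left_distrib sum.distrib)
  qed
  have f_int: "f K \<in> int_lattice" for K
  proof -
    have "f K = (\<Sum>b\<in>A. c K b *\<^sub>R b) - (\<Sum>b\<in>A. real (n K b) *\<^sub>R b)" using split[of K] by simp
    moreover have "(\<Sum>b\<in>A. c K b *\<^sub>R b) \<in> int_lattice"
      using ca[of K] pop_set_subset_lattice[OF A(1,3,4)] lattice_of_subset_int_lattice[OF A(2)] by blast
    moreover have "(\<Sum>b\<in>A. real (n K b) *\<^sub>R b) \<in> int_lattice"
      using A(2) by (auto intro!: int_lattice_sum int_lattice_closed(5))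
    ultimately show ?thesis by (simp add: int_lattice_closed(3))
  qed
  have f_bound: "norm (f K) \<le> (\<Sum>b\<in>A. norm b)" for K
    unfolding f_def
  proof (rule sum_norm_le)
    fix b assume "b \<in> A"
    show "norm (frac (c K b) *\<^sub>R b) \<le> norm b"
      using frac_lt_1[of "c K b"] by (simp add: mult_left_le_one_le)
  qed
  \<comment> \<open>Pass to a subsequence on which \<open>f\<close> and \<open>a\<close> are constant and every \<open>n\<close>-coordinate increases.\<close>
  have "finite (range f)"
    using f_int f_bound by (intro finite_bounded_int_lattice) (auto simp: bounded_iff)
  then have fin: "finite (range f \<times> A)" using A(1) by simp
  have rng: "(f i, a i) \<in> range f \<times> A" for i using ca by simp
  obtain e :: "nat \<Rightarrow> nat" and fa :: "(real ^ 'd) \<times> (real ^ 'd)"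
    where e: "strict_mono e" "\<And>i. (f (e i), a (e i)) = fa"
  proof (rule finite_range_constant_subsequence[where f = "\<lambda>i. (f i, a i)", OF fin rng])
    fix e :: "nat \<Rightarrow> nat" and y assume "strict_mono e" "\<And>i. (f (e i), a (e i)) = y"
    then show thesis by (rule that[of e y])
  qed
  obtain r :: "nat \<Rightarrow> nat" where r: "strict_mono r" "\<forall>b\<in>A. incseq (\<lambda>i. n (e (r i)) b)"
  proof -
    obtain r :: "nat \<Rightarrow> nat" where "strict_mono r \<and> (\<forall>b\<in>A. incseq (\<lambda>i. n (e (r i)) b))"
      using nat_tuples_incseq_subsequence[OF A(1), of "\<lambda>i. n (e i)"] by (rule exE)
    then show thesis using that[of r] by simp
  qed
  define s where "s i = e (r i)" for i
  have s: "strict_mono s" using e(1) r(1) by (auto simp: s_def strict_mono_def)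
  have same: "f (s i) = f (s 0)" "a (s i) = a (s 0)" for i
    using e(2)[of "r i"] e(2)[of "r 0"] by (auto simp: s_def)
  let ?a = "a (s 0)"
  have aA: "?a \<in> A" using ca by blast
  \<comment> \<open>At index \<open>j\<close> the \<open>?a\<close>-coordinate is strictly larger than at index \<open>0\<close>, so even after
    subtracting \<open>?a\<close> the element at \<open>j\<close> is the popular element at \<open>0\<close> plus elements of \<open>A\<close>.\<close>
  define j where "j = Suc (n (s 0) ?a)"
  have mono: "n (s 0) b \<le> n (s j) b" if "b \<in> A" for b
    using r(2) that by (auto simp: s_def incseq_def)
  have "real (s j) \<le> c (s j) ?a" using ca[of "s j"] same(2)[of j] by simp
  then have "s j \<le> n (s j) ?a" unfolding n_def by (simp add: le_nat_floor)
  moreover have "j \<le> s j" using s by (rule seq_suble)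
  ultimately have strict: "n (s 0) ?a < n (s j) ?a" by (simp add: j_def)
  define m where "m b = n (s j) b - n (s 0) b - (if b = ?a then 1 else 0)" for b
  have m: "real (n (s j) b) *\<^sub>R b = real (n (s 0) b) *\<^sub>R b + real (m b) *\<^sub>R b + (if b = ?a then ?a else 0)"
    if "b \<in> A" for b
  proof -
    have "n (s j) b = n (s 0) b + m b + (if b = ?a then 1 else 0)"
      using mono[OF that] strict by (auto simp: m_def)
    then show ?thesis by (auto simp: algebra_simps)
  qed
  have "(\<Sum>b\<in>A. real (n (s j) b) *\<^sub>R b)
      = (\<Sum>b\<in>A. real (n (s 0) b) *\<^sub>R b + real (m b) *\<^sub>R b + (if b = ?a then ?a else 0))"
    using m by (rule sum.cong[OF refl])
  also have "\<dots> = (\<Sum>b\<in>A. real (n (s 0) b) *\<^sub>R b) + (\<Sum>b\<in>A. real (m b) *\<^sub>R b) + ?a"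
    using A(1) aA by (simp add: sum.distrib)
  finally have "(\<Sum>b\<in>A. c (s j) b *\<^sub>R b) - ?a = (\<Sum>b\<in>A. c (s 0) b *\<^sub>R b) + (\<Sum>b\<in>A. real (m b) *\<^sub>R b)"
    using split[of "s j"] split[of "s 0"] same(1)[of j] by (simp add: algebra_simps)
  also have "\<dots> \<in> pop_set t A" using ca by (intro pop_set_add_sum[OF A(1,2)]) blast
  finally show False using ca[of "s j"] same(2)[of j] by simp
qed

section \<open>The minimum defining phi is attained\<close>

text \<open>The condition at one scale \<open>\<mu>\<close>; \<open>phi A t\<close> asks for it at all \<open>\<mu> \<ge> \<phi>\<close>.\<close>

definition dilation_step :: "(real ^ 'd) set \<Rightarrow> nat \<Rightarrow> real \<Rightarrow> bool" where
  "dilation_step A t \<mu> \<longleftrightarrow>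
     (((*\<^sub>R) \<mu> ` (convex hull A) \<inter> lattice_of A) - exc_set t A) + A
       = ((*\<^sub>R) (\<mu> + 1) ` (convex hull A) \<inter> lattice_of A) - exc_set t A"

lemma dilation_step_iff:
  fixes A :: "(real ^ 'd) set"
  assumes "finite A" "0 \<in> A" "t \<ge> 1" "0 \<le> \<mu>"
  shows "dilation_step A t \<mu> \<longleftrightarrow> ((*\<^sub>R) \<mu> ` (convex hull A) \<inter> pop_set t A) + A
       = (*\<^sub>R) (\<mu> + 1) ` (convex hull A) \<inter> pop_set t A"
  unfolding dilation_step_def using dilation_diff_exc_set[OF assms(1-3)] assms(4) by simp

text \<open>Write a popular \<open>p\<close> of the dilate by \<open>\<mu> + 1\<close> as \<open>\<Sum>c\<^sub>a a\<close> with \<open>\<Sum>c\<^sub>a = \<mu> + 1\<close>. When \<open>\<mu>\<close> is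
  large, some \<open>c\<^sub>a\<close> exceeds the bound of \<open>pop_set_coefficient_bound\<close>, and then \<open>p - a\<close> is popular
  and lies in the dilate by \<open>\<mu>\<close>.\<close>

lemma dilation_step_eventually:
  fixes A :: "(real ^ 'd) set"
  assumes A: "finite A" "A \<subseteq> int_lattice" "0 \<in> A" "t \<ge> 1"
  shows "\<exists>\<phi>\<ge>1. \<forall>\<mu>\<ge>\<phi>. dilation_step A t \<mu>"
proof -
  obtain K :: nat where K: "\<forall>c. (\<forall>a\<in>A. 0 \<le> c a) \<longrightarrow> (\<Sum>b\<in>A. c b *\<^sub>R b) \<in> pop_set t A \<longrightarrow>
    (\<forall>a\<in>A. real K \<le> c a \<longrightarrow> (\<Sum>b\<in>A. c b *\<^sub>R b) - a \<in> pop_set t A)"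
    using pop_set_coefficient_bound[OF A] by (rule exE)
  let ?H = "\<lambda>\<mu>. (*\<^sub>R) \<mu> ` (convex hull A)"
  define \<phi> where "\<phi> = 1 + real (card A) * (real K + 1)"
  have "dilation_step A t \<mu>" if \<mu>: "\<phi> \<le> \<mu>" for \<mu>
  proof -
    have \<mu>0: "0 \<le> \<mu>" using \<mu> by (simp add: \<phi>_def) (smt (verit) mult_nonneg_nonneg of_nat_0_le_iff)
    have "(?H \<mu> \<inter> pop_set t A) + A \<subseteq> ?H (\<mu> + 1) \<inter> pop_set t A"
    proof
      fix p assume "p \<in> (?H \<mu> \<inter> pop_set t A) + A"
      then obtain q a where q: "q \<in> ?H \<mu>" "q \<in> pop_set t A" "a \<in> A" "p = q + a"
        by (elim set_plus_elim IntE) blast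
      obtain c where c: "\<forall>a\<in>A. 0 \<le> c a" "sum c A = \<mu>" "(\<Sum>a\<in>A. c a *\<^sub>R a) = q"
        by (rule dilationE[OF A(1) q(1) \<mu>0])
      let ?c = "\<lambda>b. c b + (if b = a then 1 else 0)"
      have "(\<Sum>b\<in>A. ?c b *\<^sub>R b) = (\<Sum>b\<in>A. c b *\<^sub>R b + (if b = a then a else 0))"
        by (intro sum.cong) (auto simp: scaleR_left_distrib)
      then have "(\<Sum>b\<in>A. ?c b *\<^sub>R b) = p" using c q A(1) by (simp add: sum.distrib)
      moreover have "sum ?c A = \<mu> + 1" using c q A(1) by (simp add: sum.distrib)
      ultimately have "p \<in> ?H (\<mu> + 1)"
        using c(1) by (intro dilationI[OF A(1,3), of ?c]) auto
      then show "p \<in> ?H (\<mu> + 1) \<inter> pop_set t A"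
        using pop_set_add_element[OF A(1,2) q(2,3)] q(4) by simp
    qed
    moreover have "?H (\<mu> + 1) \<inter> pop_set t A \<subseteq> (?H \<mu> \<inter> pop_set t A) + A"
    proof
      fix p assume p: "p \<in> ?H (\<mu> + 1) \<inter> pop_set t A"
      then have "p \<in> ?H (\<mu> + 1)" by simp
      then obtain c where c: "\<forall>a\<in>A. 0 \<le> c a" "sum c A = \<mu> + 1" "(\<Sum>a\<in>A. c a *\<^sub>R a) = p"
        by (rule dilationE[OF A(1)]) (use \<mu>0 in simp)
      have "\<exists>a\<in>A. 1 \<le> c a \<and> p - a \<in> pop_set t A"
      \<comment> \<open>For \<open>c 0 \<ge> 1\<close> the element \<open>a = 0\<close> serves; otherwise a large coefficient exists by averaging.\<close>
      proof (cases "1 \<le> c 0")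
        case True
        then show ?thesis using A(3) p by auto
      next
        case False
        have "\<exists>a\<in>A. real K + 1 \<le> c a"
        proof (rule ccontr)
          assume "\<not> ?thesis"
          then have "sum c A \<le> (\<Sum>a\<in>A. real K + 1)" by (intro sum_mono) force
          then show False using c(2) \<mu> by (simp add: \<phi>_def)
        qed
        then show ?thesis using K[THEN spec[of _ c]] c(1,3) p by force
      qed
      then obtain a where a: "a \<in> A" "1 \<le> c a" "p - a \<in> pop_set t A" by blast
      let ?c = "\<lambda>b. c b - (if b = a then 1 else 0)"
      have "(\<Sum>b\<in>A. ?c b *\<^sub>R b) = (\<Sum>b\<in>A. c b *\<^sub>R b - (if b = a then a else 0))"
        by (intro sum.cong) (auto simp: scaleR_left_diff_distrib)
      then have "(\<Sum>b\<in>A. ?c b *\<^sub>R b) = p - a" using c a A(1) by (simp add: sum_subtractf)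
      moreover have "sum ?c A = \<mu>" using c a A(1) by (simp add: sum_subtractf)
      ultimately have "p - a \<in> ?H \<mu>"
        using c(1) a(2) by (intro dilationI[OF A(1,3), of ?c]) auto
      then have "(p - a) + a \<in> (?H \<mu> \<inter> pop_set t A) + A" using a by (intro set_plus_intro) auto
      then show "p \<in> (?H \<mu> \<inter> pop_set t A) + A" by simp
    qed
    ultimately show ?thesis using dilation_step_iff[OF A(1,3,4) \<mu>0] by blast
  qed
  moreover have "1 \<le> \<phi>" by (simp add: \<phi>_def)
  ultimately show ?thesis by blast
qed

text \<open>The bounded set of lattice points is finite and the hull is closed, so a lattice point
  outside the dilate by \<open>\<mu>\<close> stays outside the dilates by slightly larger scales.\<close>

lemma lattice_points_dilation_right_constant:
  fixes A :: "(real ^ 'd) set"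
  assumes A: "finite A" "A \<subseteq> int_lattice" "0 \<in> A" and \<mu>: "0 < \<mu>"
  shows "\<forall>\<^sub>F \<nu> in at_right \<mu>.
    (*\<^sub>R) \<nu> ` (convex hull A) \<inter> lattice_of A = (*\<^sub>R) \<mu> ` (convex hull A) \<inter> lattice_of A"
proof -
  let ?H = "\<lambda>\<mu>. (*\<^sub>R) \<mu> ` (convex hull A)"
  define F where "F = ?H (\<mu> + 1) \<inter> lattice_of A - ?H \<mu>"
  have comp: "compact (convex hull A)" using A(1) by (simp add: finite_imp_compact_convex_hull)
  have "finite F"
    unfolding F_def using comp lattice_of_subset_int_lattice[OF A(2)]
    by (intro finite_bounded_int_lattice) (auto intro: bounded_subset[OF bounded_scaling[OF compact_imp_bounded]])
  moreover have "\<forall>\<^sub>F \<nu> in at_right \<mu>. p \<notin> ?H \<nu>" if "p \<in> F" for p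
  proof -
    have mem: "p \<in> ?H \<nu> \<longleftrightarrow> (1 / \<nu>) *\<^sub>R p \<in> convex hull A" if "0 < \<nu>" for \<nu>
    proof
      assume "(1 / \<nu>) *\<^sub>R p \<in> convex hull A"
      then show "p \<in> ?H \<nu>" using that by (intro image_eqI[of _ _ "(1 / \<nu>) *\<^sub>R p"]) auto
    qed (use that in auto)
    have "((\<lambda>\<nu>. (1 / \<nu>) *\<^sub>R p) \<longlongrightarrow> (1 / \<mu>) *\<^sub>R p) (at_right \<mu>)"
      using \<mu> by (intro tendsto_intros) auto
    moreover have "open (- (convex hull A))" using comp by (simp add: compact_imp_closed open_Compl)
    moreover have "(1 / \<mu>) *\<^sub>R p \<in> - (convex hull A)" using that mem[OF \<mu>] by (simp add: F_def)
    ultimately have "\<forall>\<^sub>F \<nu> in at_right \<mu>. (1 / \<nu>) *\<^sub>R p \<in> - (convex hull A)"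
      by (rule topological_tendstoD)
    with eventually_at_right_less[of \<mu>] show ?thesis
    proof eventually_elim
      case (elim \<nu>)
      then show ?case using \<mu> mem[of \<nu>] by simp
    qed
  qed
  ultimately have "\<forall>\<^sub>F \<nu> in at_right \<mu>. \<forall>p\<in>F. p \<notin> ?H \<nu>" by (simp add: eventually_ball_finite)
  moreover have "\<forall>\<^sub>F \<nu> in at_right \<mu>. \<nu> < \<mu> + 1" by (rule eventually_at_right_real[THEN eventually_mono]) auto
  moreover note eventually_at_right_less[of \<mu>]
  ultimately show ?thesis
  proof eventually_elim
    case (elim \<nu>)
    then have "?H \<mu> \<subseteq> ?H \<nu>" "?H \<nu> \<subseteq> ?H (\<mu> + 1)"
      using dilation_mono[OF A(1,3), of \<mu> \<nu>] dilation_mono[OF A(1,3), of \<nu> "\<mu> + 1"] \<mu> by simp_all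
    with elim show ?case unfolding F_def by blast
  qed
qed

text \<open>The suitable \<open>\<phi>\<close> form an up-set that is nonempty by \<open>dilation_step_eventually\<close>. Its infimum
  belongs to it, because both sides of the step equation are constant immediately to the right
  of any scale. Hence the least element exists and \<open>phi\<close> has the properties that its definition
  asks for.\<close>

lemma phi_attained:
  fixes A :: "(real ^ 'd) set"
  assumes A: "finite A" "A \<subseteq> int_lattice" "0 \<in> A" "t \<ge> 1"
  shows "1 \<le> phi A t" "\<And>\<mu>. phi A t \<le> \<mu> \<Longrightarrow> dilation_step A t \<mu>"
proof -
  let ?G = "{\<phi>. 1 \<le> \<phi> \<and> (\<forall>\<mu>\<ge>\<phi>. dilation_step A t \<mu>)}"
  define \<phi> where "\<phi> = Inf ?G"
  have ne: "?G \<noteq> {}" using dilation_step_eventually[OF A] by auto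
  have bdd: "bdd_below ?G" by (auto intro: bdd_belowI)
  have \<phi>1: "1 \<le> \<phi>" unfolding \<phi>_def using ne by (intro cInf_greatest) auto
  have above: "dilation_step A t \<mu>" if "\<phi> < \<mu>" for \<mu>
  proof -
    have "\<exists>\<psi>\<in>?G. \<psi> < \<mu>" using that cInf_less_iff[OF ne bdd] unfolding \<phi>_def by blast
    then obtain \<psi> where "\<psi> \<in> ?G" "\<psi> < \<mu>" by blast
    then show ?thesis by auto
  qed
  have "dilation_step A t \<phi>"
  proof -
    let ?L = "\<lambda>\<mu>. (*\<^sub>R) \<mu> ` (convex hull A) \<inter> lattice_of A"
    have "\<forall>\<^sub>F \<nu> in at_right (\<phi> + 1). ?L \<nu> = ?L (\<phi> + 1)"
      using \<phi>1 by (intro lattice_points_dilation_right_constant[OF A(1-3)]) simp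
    then have "\<forall>\<^sub>F \<nu> in at_right \<phi>. ?L (\<nu> + 1) = ?L (\<phi> + 1)"
      by (simp add: eventually_at_right_to_0[of _ "\<phi> + 1"] eventually_at_right_to_0[of _ \<phi>] add.assoc)
    moreover have "\<forall>\<^sub>F \<nu> in at_right \<phi>. ?L \<nu> = ?L \<phi>"
      using \<phi>1 by (intro lattice_points_dilation_right_constant[OF A(1-3)]) simp
    moreover note eventually_at_right_less[of \<phi>]
    ultimately have "\<forall>\<^sub>F \<nu> in at_right \<phi>. dilation_step A t \<phi>"
    proof eventually_elim
      case (elim \<nu>)
      then show ?case using above[of \<nu>] unfolding dilation_step_def by simp
    qed
    then show ?thesis by simp
  qed
  then have step: "dilation_step A t \<mu>" if "\<phi> \<le> \<mu>" for \<mu> using above[of \<mu>] that by force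
  have "phi A t = \<phi>"
    unfolding phi_def dilation_step_def[symmetric]
  proof (rule Least_equality)
    show "1 \<le> \<phi> \<and> (\<forall>\<mu>\<ge>\<phi>. dilation_step A t \<mu>)" using \<phi>1 step by blast
    show "\<And>y. 1 \<le> y \<and> (\<forall>\<mu>\<ge>y. dilation_step A t \<mu>) \<Longrightarrow> \<phi> \<le> y"
      unfolding \<phi>_def using bdd by (intro cInf_lower) auto
  qed
  then show "1 \<le> phi A t" "\<And>\<mu>. phi A t \<le> \<mu> \<Longrightarrow> dilation_step A t \<mu>" using \<phi>1 step by auto
qed

section \<open>From popularity to representations of bounded length\<close>

text \<open>Above \<open>phi\<close>, the step equation removes one summand from \<open>A\<close> while the scale drops by one.\<close>

lemma hfold_descent:
  fixes A :: "(real ^ 'd) set"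
  assumes A: "finite A" "A \<subseteq> int_lattice" "0 \<in> A" "t \<ge> 1"
    and p: "p \<in> (*\<^sub>R) (phi A t + real s) ` (convex hull A) \<inter> pop_set t A"
  shows "\<exists>q \<in> (*\<^sub>R) (phi A t) ` (convex hull A) \<inter> pop_set t A.
    \<forall>m. q \<in> hfold t m A \<longrightarrow> p \<in> hfold t (m + s) A"
  using p
proof (induction s arbitrary: p)
  case 0
  then show ?case by (intro bexI[of _ p]) auto
next
  case (Suc s)
  let ?H = "\<lambda>\<mu>. (*\<^sub>R) \<mu> ` (convex hull A)"
  have phi1: "1 \<le> phi A t" by (rule phi_attained(1)[OF A])
  have "dilation_step A t (phi A t + real s)" by (rule phi_attained(2)[OF A]) simp
  then have "(?H (phi A t + real s) \<inter> pop_set t A) + A = ?H (phi A t + real s + 1) \<inter> pop_set t A"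
    using phi1 by (subst (asm) dilation_step_iff[OF A(1,3,4)]) auto
  moreover have "phi A t + real (Suc s) = phi A t + real s + 1" by simp
  ultimately have "p \<in> (?H (phi A t + real s) \<inter> pop_set t A) + A" using Suc.prems by metis
  then obtain q a where q: "q \<in> ?H (phi A t + real s) \<inter> pop_set t A" "a \<in> A" "p = q + a"
    by (elim set_plus_elim) blast
  obtain q' where q': "q' \<in> ?H (phi A t) \<inter> pop_set t A"
    "\<forall>m. q' \<in> hfold t m A \<longrightarrow> q \<in> hfold t (m + s) A"
    using Suc.IH[OF q(1)] by blast
  have "p \<in> hfold t (m + Suc s) A" if "q' \<in> hfold t m A" for m
    using hfold_add_element[OF A(1,2) _ q(2)] q'(2) that q(3) by auto
  then show ?case using q'(1) by blast
qed

lemma admissible_delta: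
  fixes A :: "(real ^ 'd) set"
  assumes "finite A" "A - {0} \<noteq> {}" "admissible A u"
  shows "0 < delta_min A u" "delta_min A u \<le> delta_max A u"
    "\<And>a. a \<in> A - {0} \<Longrightarrow> delta_min A u \<le> a \<bullet> u"
    "\<And>a. a \<in> A - {0} \<Longrightarrow> a \<bullet> u \<le> delta_max A u"
proof -
  have pos: "0 < a \<bullet> u" if a: "a \<in> A - {0}" for a
  proof -
    have "(\<Sum>b\<in>A. (if b = a then 1 else 0) *\<^sub>R b) = a"
      using a assms(1) by (simp add: if_distrib[of "\<lambda>r. r *\<^sub>R _"] cong: if_cong)
    then have "a \<in> cone_of A"
      unfolding cone_of_def by (intro CollectI exI[of _ "\<lambda>b. if b = a then 1 else 0"]) auto
    then show ?thesis using assms(3) a by (auto simp: admissible_def inner_commute)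
  qed
  have fin: "finite ((\<lambda>a. a \<bullet> u) ` (A - {0}))" "(\<lambda>a. a \<bullet> u) ` (A - {0}) \<noteq> {}"
    using assms(1,2) by auto
  show "0 < delta_min A u" unfolding delta_min_def using pos by (subst Min_gr_iff[OF fin]) auto
  show lo: "\<And>a. a \<in> A - {0} \<Longrightarrow> delta_min A u \<le> a \<bullet> u"
    unfolding delta_min_def using fin by (intro Min_le) auto
  show hi: "\<And>a. a \<in> A - {0} \<Longrightarrow> a \<bullet> u \<le> delta_max A u"
    unfolding delta_max_def using fin by (intro Max_ge) auto
  obtain a where "a \<in> A - {0}" using assms(2) by blast
  from lo[OF this] hi[OF this] show "delta_min A u \<le> delta_max A u" by linarith
qed

text \<open>Evaluate the functional \<open>u\<close>: every nonzero summand of the representation contributes at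
  least \<open>\<delta>\<close>, whereas \<open>u\<close> is at most \<open>\<mu> \<Delta>\<close> on the dilate by \<open>\<mu>\<close>.\<close>

lemma representation_length_le:
  fixes A :: "(real ^ 'd) set" and k :: "real ^ 'd \<Rightarrow> nat"
  assumes A: "finite A" "A - {0} \<noteq> {}" "admissible A u"
    and \<mu>: "0 \<le> \<mu>" "(\<Sum>a\<in>A. real (k a) *\<^sub>R a) \<in> (*\<^sub>R) \<mu> ` (convex hull A)"
  shows "real (sum k (A - {0})) \<le> delta_max A u / delta_min A u * \<mu>"
proof -
  note \<delta> = admissible_delta[OF A]
  obtain c where c: "\<forall>a\<in>A. 0 \<le> c a" "sum c A = \<mu>" "(\<Sum>a\<in>A. c a *\<^sub>R a) = (\<Sum>a\<in>A. real (k a) *\<^sub>R a)"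
    by (rule dilationE[OF A(1) \<mu>(2,1)])
  have drop0: "(\<Sum>a\<in>A. f a * (a \<bullet> u)) = (\<Sum>a\<in>A - {0}. f a * (a \<bullet> u))" for f
    using A(1) by (intro sum.mono_neutral_right) auto
  have "real (sum k (A - {0})) * delta_min A u = (\<Sum>a\<in>A - {0}. real (k a) * delta_min A u)"
    by (simp add: sum_distrib_right)
  also have "\<dots> \<le> (\<Sum>a\<in>A - {0}. real (k a) * (a \<bullet> u))"
    using \<delta>(3) by (intro sum_mono mult_left_mono) auto
  also have "\<dots> = (\<Sum>a\<in>A. real (k a) *\<^sub>R a) \<bullet> u" by (simp add: inner_sum_left drop0)
  also have "\<dots> = (\<Sum>a\<in>A. c a *\<^sub>R a) \<bullet> u" using c(3) by simp
  also have "\<dots> = (\<Sum>a\<in>A - {0}. c a * (a \<bullet> u))" by (simp add: inner_sum_left drop0)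
  also have "\<dots> \<le> (\<Sum>a\<in>A - {0}. c a * delta_max A u)"
    using \<delta>(4) c(1) by (intro sum_mono mult_left_mono) auto
  also have "\<dots> = sum c (A - {0}) * delta_max A u" by (simp add: sum_distrib_right)
  also have "\<dots> \<le> \<mu> * delta_max A u"
  proof (rule mult_right_mono)
    show "sum c (A - {0}) \<le> \<mu>" using c A(1) by (auto simp: c(2)[symmetric] intro: sum_mono2)
    show "0 \<le> delta_max A u" using \<delta>(1,2) by linarith
  qed
  finally show ?thesis using \<delta>(1) by (simp add: field_simps)
qed

text \<open>Descend from the scale \<open>h - c\<close> to the scale \<open>phi\<close>, which costs about \<open>h - c - phi\<close> summands. The
  remaining element needs at most \<open>(\<Delta> / \<delta>) phi \<le> c\<close> nonzero summands in any representation,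
  so all its representations can be padded by zeros to use up the rest of the length \<open>h\<close>.\<close>

lemma hfold_of_pop_set:
  fixes A :: "(real ^ 'd) set"
  assumes A: "finite A" "A \<subseteq> int_lattice" "0 \<in> A" "t \<ge> 1" "A - {0} \<noteq> {}" "admissible A u"
    and c: "delta_max A u / delta_min A u * phi A t \<le> c" "c \<le> real h"
    and p: "p \<in> (*\<^sub>R) (real h - c) ` (convex hull A)" "p \<in> pop_set t A"
  shows "p \<in> hfold t h A"
proof -
  let ?H = "\<lambda>\<mu>. (*\<^sub>R) \<mu> ` (convex hull A)"
  have phi1: "1 \<le> phi A t" by (rule phi_attained(1)[OF A(1-4)])
  define s where "s = nat \<lceil>real h - c - phi A t\<rceil>"
  have "real h - c \<le> phi A t + real s" unfolding s_def by linarith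
  then have "p \<in> ?H (phi A t + real s)"
    using dilation_mono[OF A(1,3), of "real h - c"] c(2) p(1) by auto
  then obtain q where q: "q \<in> ?H (phi A t)" "q \<in> pop_set t A"
    "\<forall>m. q \<in> hfold t m A \<longrightarrow> p \<in> hfold t (m + s) A"
    using hfold_descent[OF A(1-4), of p s] p(2) by blast
  have ratio: "0 \<le> delta_max A u / delta_min A u * phi A t"
    using admissible_delta[OF A(1,5,6)] phi1 by (intro mult_nonneg_nonneg divide_nonneg_nonneg) auto
  have room: "delta_max A u / delta_min A u * phi A t \<le> real (h - s)" and "s \<le> h"
  proof -
    \<comment> \<open>Rounding up costs less than one step, which \<open>phi \<ge> 1\<close> compensates.\<close>
    have "real s \<le> real h - c \<or> s = 0"
      using phi1 unfolding s_def by linarith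
    with c ratio show "delta_max A u / delta_min A u * phi A t \<le> real (h - s)" "s \<le> h" by auto
  qed
  obtain m where m: "q \<in> hfold t m A" using q(2) by (auto simp: pop_set_def)
  have "rep_count A m q \<le> rep_count A (h - s) q"
  proof (rule rep_count_pad_zero[OF A(1,3)])
    fix k :: "real ^ 'd \<Rightarrow> nat" assume "(\<Sum>a\<in>A. real (k a) *\<^sub>R a) = q"
    then have "real (sum k (A - {0})) \<le> delta_max A u / delta_min A u * phi A t"
      using q(1) phi1 by (intro representation_length_le[OF A(1,5,6)]) auto
    then show "sum k (A - {0}) \<le> h - s" using room by linarith
  qed
  then have "q \<in> hfold t (h - s) A" using m by (simp add: hfold_def)
  with q(3) \<open>s \<le> h\<close> show ?thesis by fastforce
qed

section \<open>Extremal points with integer normals\<close>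

lemma ex_points_subset:
  fixes A :: "(real ^ 'd) set"
  shows "ex_points A \<subseteq> A"
proof
  fix v assume "v \<in> ex_points A"
  then obtain n c where v: "v \<in> convex hull A" "n \<bullet> v = c" "\<forall>x \<in> convex hull A - {v}. n \<bullet> x > c"
    by (auto simp: ex_points_def)
  show "v \<in> A"
  proof (rule ccontr)
    assume "v \<notin> A"
    then have "A \<subseteq> {x. n \<bullet> x > c}" using v(3) by (auto intro: hull_inc)
    then have "convex hull A \<subseteq> {x. n \<bullet> x > c}"
      by (intro hull_minimal) (auto simp: convex_halfspace_gt)
    then show False using v(1,2) by auto
  qed
qed

text \<open>Round a large multiple of \<open>n\<close> to an integer vector: the error stays bounded while the
  finitely many positive values \<open>n \<bullet> w\<close> grow.\<close>

lemma integer_normal_exists: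
  fixes n :: "real ^ 'd"
  assumes "finite W" "\<And>w. w \<in> W \<Longrightarrow> 0 < n \<bullet> w"
  shows "\<exists>m \<in> int_lattice. \<forall>w\<in>W. 0 < m \<bullet> w"
proof -
  have "\<forall>\<^sub>F K :: real in at_top. real CARD('d) * norm w < K * (n \<bullet> w)" if "w \<in> W" for w
    using eventually_gt_at_top[of "real CARD('d) * norm w / (n \<bullet> w)"]
    by eventually_elim (use assms(2)[OF that] in \<open>simp add: pos_divide_less_eq\<close>)
  then have "\<forall>\<^sub>F K :: real in at_top. \<forall>w\<in>W. real CARD('d) * norm w < K * (n \<bullet> w)"
    using assms(1) by (simp add: eventually_ball_finite)
  then obtain K :: real where K: "\<forall>w\<in>W. real CARD('d) * norm w < K * (n \<bullet> w)"
    using eventually_happens' trivial_limit_at_top_linorder by blast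
  define m :: "real ^ 'd" where "m = (\<chi> i. real_of_int \<lfloor>K * n $ i\<rfloor>)"
  have "norm (K *\<^sub>R n - m) \<le> (\<Sum>i\<in>UNIV. \<bar>(K *\<^sub>R n - m) $ i\<bar>)" by (rule norm_le_l1_cart)
  also have "\<dots> \<le> (\<Sum>i\<in>(UNIV :: 'd set). 1)"
    unfolding m_def by (intro sum_mono) (simp, linarith)
  finally have close: "norm (K *\<^sub>R n - m) \<le> real CARD('d)" by simp
  have "0 < m \<bullet> w" if "w \<in> W" for w
  proof -
    have "(K *\<^sub>R n - m) \<bullet> w \<le> norm (K *\<^sub>R n - m) * norm w" by (rule norm_cauchy_schwarz)
    also have "\<dots> \<le> real CARD('d) * norm w" using close by (intro mult_right_mono) auto
    also have "\<dots> < K * (n \<bullet> w)" using K that by blast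
    finally show ?thesis by (simp add: inner_diff_left)
  qed
  moreover have "m \<in> int_lattice" by (simp add: m_def int_lattice_def)
  ultimately show ?thesis by blast
qed

text \<open>An extreme point is strictly separated from the hull of the other points of \<open>A\<close>; the
  normal can be replaced by an integer one since only finitely many strict inequalities matter.\<close>

lemma extreme_point_in_ex_points:
  fixes A :: "(real ^ 'd) set"
  assumes "finite A" "v extreme_point_of (convex hull A)"
  shows "v \<in> ex_points A"
proof -
  have vA: "v \<in> A" using assms(2) by (rule extreme_point_of_convex_hull)
  have "convex (convex hull A - {v})" using assms(2) extreme_point_of_stillconvex by blast
  then have "convex hull (A - {v}) \<subseteq> convex hull A - {v}"
    by (intro hull_minimal) (auto intro: hull_inc)
  moreover have "closed (convex hull (A - {v}))"
    using assms(1) by (simp add: compact_imp_closed finite_imp_compact_convex_hull)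
  ultimately obtain n b where n: "n \<bullet> v < b" "\<forall>x\<in>convex hull (A - {v}). n \<bullet> x > b"
    using separating_hyperplane_closed_point[of "convex hull (A - {v})" v] by auto
  have "0 < n \<bullet> w" if w: "w \<in> (\<lambda>a. a - v) ` (A - {v})" for w
  proof -
    obtain a where a: "a \<in> A - {v}" "w = a - v" using w by blast
    then have "b < n \<bullet> a" using n(2) hull_inc[of a "A - {v}" convex] by blast
    with n(1) show ?thesis by (simp add: a(2) inner_diff_right)
  qed
  then obtain m where m: "m \<in> int_lattice" "\<forall>w \<in> (\<lambda>a. a - v) ` (A - {v}). 0 < m \<bullet> w"
    using integer_normal_exists[of "(\<lambda>a. a - v) ` (A - {v})" n] assms(1) by blast
  have "m \<bullet> v < m \<bullet> x" if x: "x \<in> convex hull A - {v}" for x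
  proof -
    obtain u where u: "\<forall>a\<in>A. 0 \<le> u a" "sum u A = 1" "(\<Sum>a\<in>A. u a *\<^sub>R a) = x"
      using x assms(1) by (auto simp: convex_hull_finite)
    have diff: "x - v = (\<Sum>a\<in>A. u a *\<^sub>R (a - v))"
      using u(2,3) by (simp add: scaleR_right_diff_distrib sum_subtractf scaleR_sum_left[symmetric])
    have "\<exists>a\<in>A. 0 < u a * (m \<bullet> (a - v))"
    proof (rule ccontr)
      assume none: "\<not> ?thesis"
      have "u a *\<^sub>R (a - v) = 0" if "a \<in> A" for a
      proof (cases "a = v")
        case False
        then have "0 < m \<bullet> (a - v)" using m(2) that by blast
        moreover have "\<not> 0 < u a * (m \<bullet> (a - v))" using none that by blast
        ultimately have "u a = 0" using u(1) that by (simp add: zero_less_mult_iff) force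
        then show ?thesis by simp
      qed simp
      then have "x - v = 0" unfolding diff by (rule sum.neutral[OF ballI])
      then show False using x by simp
    qed
    then obtain a where a: "a \<in> A" "0 < u a * (m \<bullet> (a - v))" by blast
    have nonneg: "0 \<le> u a * (m \<bullet> (a - v))" if "a \<in> A" for a
    proof (cases "a = v")
      case False
      then have "0 < m \<bullet> (a - v)" using m(2) that by blast
      then show ?thesis using u(1) that by simp
    qed simp
    have "0 < (\<Sum>a\<in>A. u a * (m \<bullet> (a - v)))"
      using assms(1) a nonneg by (rule sum_pos2)
    also have "\<dots> = m \<bullet> (x - v)" unfolding diff by (simp add: inner_sum_right)
    finally show ?thesis by (simp add: inner_diff_right)
  qed
  then show ?thesis
    unfolding ex_points_def using m(1) vA by (auto intro: hull_inc)
qed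

lemma convex_hull_ex_points:
  fixes A :: "(real ^ 'd) set"
  assumes "finite A"
  shows "convex hull (ex_points A) = convex hull A"
proof
  show "convex hull (ex_points A) \<subseteq> convex hull A" by (intro hull_mono ex_points_subset)
  have "convex hull A = convex hull {v. v extreme_point_of (convex hull A)}"
    using assms by (intro Krein_Milman_Minkowski) (auto simp: finite_imp_compact_convex_hull)
  also have "\<dots> \<subseteq> convex hull (ex_points A)"
    using extreme_point_in_ex_points[OF assms] by (intro hull_mono) auto
  finally show "convex hull A \<subseteq> convex hull (ex_points A)" .
qed

lemma span_ex_points:
  fixes A :: "(real ^ 'd) set"
  assumes "finite A" "span A = UNIV"
  shows "span (ex_points A) = UNIV"
proof -
  have "A \<subseteq> convex hull (ex_points A)" using convex_hull_ex_points[OF assms(1)] hull_subset[of A convex] by simp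
  also have "\<dots> \<subseteq> span (ex_points A)" by (rule convex_hull_subset_span)
  finally have "span A \<subseteq> span (ex_points A)" by (simp add: span_minimal)
  then show ?thesis using assms(2) by blast
qed

section \<open>Simplices with a vertex at the origin\<close>

text \<open>The conical form of Caratheodory's theorem. A linear relation \<open>u\<close> among the support is
  subtracted until a coefficient vanishes; choosing the sign of \<open>u\<close> so that its coefficients have
  nonnegative sum keeps the total coefficient from growing.\<close>

lemma conic_combination_independent_support:
  fixes E :: "(real ^ 'd) set"
  assumes "finite E" "\<forall>e\<in>E. 0 \<le> c e"
  shows "\<exists>S d. S \<subseteq> E \<and> independent S \<and> (\<forall>e\<in>S. 0 \<le> d e) \<and>
    (\<Sum>e\<in>S. d e *\<^sub>R e) = (\<Sum>e\<in>E. c e *\<^sub>R e) \<and> sum d S \<le> sum c E"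
  using assms
proof (induction "card E" arbitrary: E c rule: less_induct)
  case less
  show ?case
  proof (cases "independent E")
    case True
    then show ?thesis using less.prems by (intro exI[of _ E] exI[of _ c]) simp
  next
    case False
    then obtain u0 where u0: "\<exists>v\<in>E. u0 v \<noteq> 0" "(\<Sum>v\<in>E. u0 v *\<^sub>R v) = 0"
      using dependent_finite[OF less.prems(1)] by auto
    define u where "u = (if 0 \<le> sum u0 E then u0 else (\<lambda>v. - u0 v))"
    have u: "\<exists>v\<in>E. u v \<noteq> 0" "(\<Sum>v\<in>E. u v *\<^sub>R v) = 0" "0 \<le> sum u E"
      using u0 by (auto simp: u_def sum_negf)
    define P where "P = {e \<in> E. 0 < u e}"
    have "P \<noteq> {}"
    proof
      assume "P = {}"
      then have np: "\<forall>e\<in>E. u e \<le> 0" by (auto simp: P_def not_less)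
      then have "sum u E = 0" using u(3) by (simp add: sum_nonpos antisym)
      then have "\<forall>e\<in>E. u e = 0"
        using np less.prems(1) sum_nonneg_eq_0_iff[of E "\<lambda>e. - u e"] by (simp add: sum_negf)
      then show False using u(1) by blast
    qed
    have finP: "finite P" using less.prems(1) by (simp add: P_def)
    \<comment> \<open>The largest multiple of \<open>u\<close> that can be subtracted with all coefficients staying nonnegative.\<close>
    define \<theta> where "\<theta> = Min ((\<lambda>e. c e / u e) ` P)"
    have "\<theta> \<in> (\<lambda>e. c e / u e) ` P" unfolding \<theta>_def using finP \<open>P \<noteq> {}\<close> by (intro Min_in) auto
    then obtain e0 where e0: "e0 \<in> P" "\<theta> = c e0 / u e0" by blast
    have \<theta>0: "0 \<le> \<theta>" using e0 less.prems(2) by (simp add: P_def)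
    define d where "d e = c e - \<theta> * u e" for e
    have d0: "d e0 = 0" using e0 by (simp add: d_def P_def)
    have dpos: "0 \<le> d e" if "e \<in> E" for e
    proof (cases "0 < u e")
      case True
      then have "e \<in> P" using that by (simp add: P_def)
      then have "\<theta> \<le> c e / u e" unfolding \<theta>_def using finP by (intro Min_le) auto
      then show ?thesis using True by (simp add: d_def pos_le_divide_eq)
    next
      case False
      then have "\<theta> * u e \<le> 0" using \<theta>0 by (simp add: mult_nonneg_nonpos)
      then show ?thesis using less.prems(2) that by (force simp: d_def)
    qed
    let ?E = "E - {e0}"
    have e0E: "e0 \<in> E" using e0 by (simp add: P_def)
    have "(\<Sum>e\<in>?E. d e *\<^sub>R e) = (\<Sum>e\<in>E. d e *\<^sub>R e)"
      using d0 less.prems(1) by (intro sum.mono_neutral_left) auto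
    also have "\<dots> = (\<Sum>e\<in>E. c e *\<^sub>R e) - \<theta> *\<^sub>R (\<Sum>e\<in>E. u e *\<^sub>R e)"
      by (simp add: d_def scaleR_left_diff_distrib sum_subtractf scaleR_sum_right)
    finally have sum_same: "(\<Sum>e\<in>?E. d e *\<^sub>R e) = (\<Sum>e\<in>E. c e *\<^sub>R e)" using u(2) by simp
    have "sum d ?E = sum d E" using d0 less.prems(1) by (intro sum.mono_neutral_left) auto
    also have "\<dots> = sum c E - \<theta> * sum u E" by (simp add: d_def sum_subtractf sum_distrib_left)
    also have "\<dots> \<le> sum c E" using \<theta>0 u(3) by simp
    finally have sum_le: "sum d ?E \<le> sum c E" .
    have "card ?E < card E" using less.prems(1) e0E by (rule card_Diff1_less)
    then obtain S d' where "S \<subseteq> ?E \<and> independent S \<and> (\<forall>e\<in>S. 0 \<le> d' e) \<and>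
        (\<Sum>e\<in>S. d' e *\<^sub>R e) = (\<Sum>e\<in>?E. d e *\<^sub>R e) \<and> sum d' S \<le> sum d ?E"
      using less.hyps[of ?E d] less.prems(1) dpos by auto
    then show ?thesis using sum_same sum_le by (intro exI[of _ S] exI[of _ d']) auto
  qed
qed

text \<open>Coning from \<open>0\<close>: represent \<open>p\<close> with linearly independent nonzero points, complete them to a
  basis, and give the unused mass to the vertex \<open>0\<close>.\<close>

lemma dilation_simplex_decomposition:
  fixes E :: "(real ^ 'd) set"
  assumes E: "finite E" "0 \<in> E" "span E = UNIV"
    and p: "0 \<le> \<mu>" "p \<in> (*\<^sub>R) \<mu> ` (convex hull E)"
  obtains B c where "0 \<in> B" "B \<subseteq> E" "card B = CARD('d) + 1" "span B = UNIV"
    "\<forall>b\<in>B. 0 \<le> c b" "sum c B = \<mu>" "(\<Sum>b\<in>B. c b *\<^sub>R b) = p"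
proof -
  obtain c where c: "\<forall>a\<in>E. 0 \<le> c a" "sum c E = \<mu>" "(\<Sum>a\<in>E. c a *\<^sub>R a) = p"
    by (rule dilationE[OF E(1) p(2,1)])
  have p': "(\<Sum>a\<in>E - {0}. c a *\<^sub>R a) = p" "sum c (E - {0}) \<le> \<mu>"
    using c E(2) sum.remove[OF E(1,2), of c] sum.remove[OF E(1,2), of "\<lambda>a. c a *\<^sub>R a"] by force+
  have "finite (E - {0})" "\<forall>e\<in>E - {0}. 0 \<le> c e" using E(1) c(1) by auto
  from conic_combination_independent_support[OF this] obtain S where
    "\<exists>d. S \<subseteq> E - {0} \<and> independent S \<and> (\<forall>e\<in>S. 0 \<le> d e) \<and>
      (\<Sum>e\<in>S. d e *\<^sub>R e) = (\<Sum>e\<in>E - {0}. c e *\<^sub>R e) \<and> sum d S \<le> sum c (E - {0})"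
    by (rule exE)
  then obtain d where "S \<subseteq> E - {0} \<and> independent S \<and> (\<forall>e\<in>S. 0 \<le> d e) \<and>
      (\<Sum>e\<in>S. d e *\<^sub>R e) = (\<Sum>e\<in>E - {0}. c e *\<^sub>R e) \<and> sum d S \<le> sum c (E - {0})"
    by (rule exE)
  with p' have S: "S \<subseteq> E - {0}" "independent S" "\<forall>e\<in>S. 0 \<le> d e"
    "(\<Sum>e\<in>S. d e *\<^sub>R e) = p" "sum d S \<le> \<mu>" by auto
  obtain C where C: "S \<subseteq> C" "C \<subseteq> E - {0}" "independent C" "E - {0} \<subseteq> span C"
    using maximal_independent_subset_extend[OF S(1,2)] by blast
  have finC: "finite C" using C(2) E(1) finite_subset by blast
  have "E \<subseteq> span C" using C(4) span_0 by blast
  then have spanC: "span C = UNIV" using E(3) span_minimal[of E "span C"] by auto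
  have "card C = dim (UNIV :: (real ^ 'd) set)"
    using C(3) spanC by (intro basis_card_eq_dim) auto
  then have cardC: "card C = CARD('d)" by simp
  define c' where "c' b = (if b = 0 then \<mu> - sum d S else if b \<in> S then d b else 0)" for b
  have c'S: "c' b = d b" if "b \<in> S" for b using that S(1) by (auto simp: c'_def)
  have sC: "(\<Sum>b\<in>C. c' b *\<^sub>R b) = p"
  proof -
    have "(\<Sum>b\<in>C. c' b *\<^sub>R b) = (\<Sum>b\<in>S. c' b *\<^sub>R b)"
      using C(1,2) finC by (intro sum.mono_neutral_right) (auto simp: c'_def)
    then show ?thesis using c'S S(4) by simp
  qed
  have tC: "sum c' C = sum d S"
  proof -
    have "sum c' C = sum c' S" using C(1,2) finC by (intro sum.mono_neutral_right) (auto simp: c'_def)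
    then show ?thesis using c'S by simp
  qed
  have nz: "0 \<notin> C" using C(2) by blast
  show thesis
  proof (rule that[of "insert 0 C" c'])
    show "card (insert 0 C) = CARD('d) + 1" using cardC nz finC by simp
    show "span (insert 0 C) = UNIV" using spanC by (simp add: span_insert_0)
    show "\<forall>b\<in>insert 0 C. 0 \<le> c' b" using S(3,5) by (auto simp: c'_def)
    show "sum c' (insert 0 C) = \<mu>" using nz finC tC by (simp add: c'_def[of 0])
    show "(\<Sum>b\<in>insert 0 C. c' b *\<^sub>R b) = p" using nz finC sC by simp
  qed (use C(2) E(2) in auto)
qed

section \<open>The structure theorem\<close>

text \<open>Seen from the vertex \<open>b\<close>, the summand \<open>c\<^sub>b b\<close> becomes \<open>c\<^sub>b (b - b) = 0\<close>, so the scale drops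
  by \<open>c\<^sub>b\<close>.\<close>

lemma reflect_dilation:
  fixes A :: "(real ^ 'd) set"
  assumes "finite B" "b \<in> B" "B \<subseteq> A" and c: "\<forall>x\<in>B. 0 \<le> c x"
  shows "sum c B *\<^sub>R b - (\<Sum>x\<in>B. c x *\<^sub>R x)
    \<in> (*\<^sub>R) (sum c B - c b) ` (convex hull (reflect b A))"
proof -
  let ?c = "\<lambda>y. if y = 0 then 0 else c (b - y)"
  have inj: "inj_on (\<lambda>x. b - x) B" by (auto simp: inj_on_def)
  have "sum ?c (reflect b B) = (\<Sum>x\<in>B. if x = b then 0 else c x)"
    unfolding reflect_def by (subst sum.reindex[OF inj]) (auto intro!: sum.cong)
  also have "\<dots> = sum c B - c b"
    using assms(1,2) by (simp add: sum.remove[of B b] cong: if_cong)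
  finally have 1: "sum ?c (reflect b B) = sum c B - c b" .
  have "(\<Sum>y\<in>reflect b B. ?c y *\<^sub>R y) = (\<Sum>x\<in>B. c x *\<^sub>R (b - x))"
    unfolding reflect_def by (subst sum.reindex[OF inj]) (auto intro!: sum.cong)
  also have "\<dots> = sum c B *\<^sub>R b - (\<Sum>x\<in>B. c x *\<^sub>R x)"
    by (simp add: scaleR_right_diff_distrib sum_subtractf scaleR_sum_left)
  finally have 2: "(\<Sum>y\<in>reflect b B. ?c y *\<^sub>R y) = sum c B *\<^sub>R b - (\<Sum>x\<in>B. c x *\<^sub>R x)" .
  have "sum c B *\<^sub>R b - (\<Sum>x\<in>B. c x *\<^sub>R x)
    \<in> (*\<^sub>R) (sum c B - c b) ` (convex hull (reflect b B))"
    using assms(2) c finite_reflect[OF assms(1)]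
    by (intro dilationI[OF _ _ _ 1 2]) (auto simp: reflect_def)
  moreover have "convex hull (reflect b B) \<subseteq> convex hull (reflect b A)"
    using assms(3) by (intro hull_mono) (auto simp: reflect_def)
  ultimately show ?thesis by blast
qed

lemma hfold_reflect_iff:
  fixes A :: "(real ^ 'd) set"
  assumes "finite A" "v \<in> int_lattice"
  shows "real h *\<^sub>R v - p \<in> hfold t h (reflect v A) \<longleftrightarrow> p \<in> hfold t h A"
proof -
  have hv: "real h *\<^sub>R v \<in> int_lattice" using assms(2) by (rule int_lattice_closed(5))
  then have "real h *\<^sub>R v - p \<in> int_lattice \<longleftrightarrow> p \<in> int_lattice"
    using int_lattice_closed(3)[OF hv, of p] int_lattice_closed(3)[OF hv, of "real h *\<^sub>R v - p"] by auto
  then show ?thesis unfolding hfold_def using rep_count_reflect[OF assms(1), of v h p] by simp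
qed

lemma mem_reflect_iff: "p \<in> reflect v X \<longleftrightarrow> v - p \<in> X"
  by (force simp: reflect_def)

theorem theorem1p4:
  fixes A :: "(real ^ 'd) set" and t h :: nat and n :: "real ^ 'd \<Rightarrow> real ^ 'd"
  assumes "finite A" and "A \<subseteq> int_lattice" and "span A = UNIV"
    and "0 \<in> ex_points A"
    and "t \<ge> 1"
    and "\<And>b. b \<in> ex_points A \<Longrightarrow> admissible (reflect b A) (n b)"
    and "int h \<ge> Max {(\<Sum>b\<in>B. \<lceil>delta_max (reflect b A) (n b) / delta_min (reflect b A) (n b)
                              * phi (reflect b A) t\<rceil>) | B.
           0 \<in> B \<and> B \<subseteq> ex_points A \<and> card B = CARD('d) + 1 \<and> span B = UNIV}"
  shows "hfold t h A =
    ((*\<^sub>R) (real h) ` (convex hull A) \<inter> lattice_of A)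
      - (\<Union>v\<in>ex_points A. reflect (real h *\<^sub>R v) (exc_set t (reflect v A)))"
proof -
  let ?E = "ex_points A"
  define N where "N b = \<lceil>delta_max (reflect b A) (n b) / delta_min (reflect b A) (n b)
    * phi (reflect b A) t\<rceil>" for b
  have EA: "?E \<subseteq> A" by (rule ex_points_subset)
  have zA: "0 \<in> A" using assms(4) EA by blast
  have finE: "finite ?E" using EA assms(1) finite_subset by blast
  have spanE: "span ?E = UNIV" using assms(1,3) by (rule span_ex_points)
  have Eint: "v \<in> int_lattice" if "v \<in> ?E" for v using that EA assms(2) by blast
  have bound: "(\<Sum>b\<in>B. N b) \<le> int h"
    if "0 \<in> B" "B \<subseteq> ?E" "card B = CARD('d) + 1" "span B = UNIV" for B
  proof -
    let ?M = "{(\<Sum>b\<in>B. N b) | B.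
      0 \<in> B \<and> B \<subseteq> ?E \<and> card B = CARD('d) + 1 \<and> span B = UNIV}"
    have "finite ?M"
      by (rule finite_subset[of _ "(\<lambda>B. \<Sum>b\<in>B. N b) ` Pow ?E"]) (use finE in auto)
    moreover have "(\<Sum>b\<in>B. N b) \<in> ?M"
      using that by (intro CollectI exI[of _ B] conjI) (rule refl)
    ultimately have "(\<Sum>b\<in>B. N b) \<le> Max ?M" by (rule Max_ge)
    then show ?thesis using assms(7) unfolding N_def by linarith
  qed
  \<comment> \<open>Some simplex exists, so the maximum in the hypothesis is over a nonempty set and \<open>h\<close> is positive.\<close>
  obtain B0 where B0: "0 \<in> B0" "B0 \<subseteq> ?E" "card B0 = CARD('d) + 1" "span B0 = UNIV"
    by (rule dilation_simplex_decomposition[OF finE assms(4) spanE order_refl, of 0])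
       (use assms(4) in \<open>auto intro!: image_eqI[of _ _ 0] hull_inc\<close>)
  have reflect_ok: "finite (reflect v A)" "reflect v A \<subseteq> int_lattice" "0 \<in> reflect v A"
    "reflect v A - {0} \<noteq> {}" if v: "v \<in> ?E" for v
  proof -
    show "finite (reflect v A)" using assms(1) by (rule finite_reflect)
    show "reflect v A \<subseteq> int_lattice"
      using Eint[OF v] assms(2) by (auto simp: reflect_def intro!: int_lattice_closed(3))
    show "0 \<in> reflect v A" using v EA by (auto simp: reflect_def)
    have "\<not> B0 \<subseteq> {v}"
    proof
      assume "B0 \<subseteq> {v}"
      then have "card B0 \<le> 1" using card_mono[of "{v}" B0] by simp
      then show False using B0(3) by simp
    qed
    then obtain a where "a \<in> A" "a \<noteq> v" using B0(2) EA by blast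
    then have "v - a \<in> reflect v A - {0}" by (auto simp: reflect_def)
    then show "reflect v A - {0} \<noteq> {}" by blast
  qed
  have N1: "1 \<le> N b" if b: "b \<in> ?E" for b
  proof -
    note R = reflect_ok[OF b]
    have "1 \<le> delta_max (reflect b A) (n b) / delta_min (reflect b A) (n b)"
      using admissible_delta(1,2)[OF R(1,4) assms(6)[OF b]] by simp
    moreover have "1 \<le> phi (reflect b A) t" by (rule phi_attained(1)[OF R(1-3) assms(5)])
    ultimately have "1 * 1 \<le> delta_max (reflect b A) (n b) / delta_min (reflect b A) (n b)
      * phi (reflect b A) t" by (intro mult_mono) auto
    then show ?thesis unfolding N_def by linarith
  qed
  have h1: "1 \<le> h"
  proof -
    have "N 0 \<le> (\<Sum>b\<in>B0. N b)"
      using B0(1,2) N1 finite_subset[OF B0(2) finE] by (intro member_le_sum) force+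
    then show ?thesis using bound[OF B0] N1[OF assms(4)] by linarith
  qed
  show ?thesis
  proof (intro equalityI subsetI)
    fix p assume p: "p \<in> hfold t h A"
    have "p \<notin> reflect (real h *\<^sub>R v) (exc_set t (reflect v A))" if v: "v \<in> ?E" for v
    proof -
      have "real h *\<^sub>R v - p \<in> pop_set t (reflect v A)"
        using p hfold_reflect_iff[OF assms(1) Eint[OF v]] h1 by (auto simp: pop_set_def)
      then show ?thesis by (simp add: mem_reflect_iff exc_set_def)
    qed
    then show "p \<in> ((*\<^sub>R) (real h) ` (convex hull A) \<inter> lattice_of A)
      - (\<Union>v\<in>?E. reflect (real h *\<^sub>R v) (exc_set t (reflect v A)))"
      using hfold_subset_dilation[OF assms(1) zA assms(5) p] by blast
  next
    fix p assume p: "p \<in> ((*\<^sub>R) (real h) ` (convex hull A) \<inter> lattice_of A)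
      - (\<Union>v\<in>?E. reflect (real h *\<^sub>R v) (exc_set t (reflect v A)))"
    then have "p \<in> (*\<^sub>R) (real h) ` (convex hull ?E)"
      using convex_hull_ex_points[OF assms(1)] by simp
    then obtain B c where B: "0 \<in> B" "B \<subseteq> ?E" "card B = CARD('d) + 1" "span B = UNIV"
      and c: "\<forall>b\<in>B. 0 \<le> c b" "sum c B = real h" "(\<Sum>b\<in>B. c b *\<^sub>R b) = p"
      by (rule dilation_simplex_decomposition[OF finE assms(4) spanE of_nat_0_le_iff])
    have finB: "finite B" using B(2) finE by (rule finite_subset)
    \<comment> \<open>The coefficients sum to \<open>h \<ge> \<Sum>N\<close>, so at some vertex the coefficient is large; the argument
      then takes place at that vertex.\<close>
    have "\<exists>b\<in>B. real_of_int (N b) \<le> c b"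
    proof (rule ccontr)
      assume "\<not> ?thesis"
      then have "sum c B < (\<Sum>b\<in>B. real_of_int (N b))"
        using finB B(1) by (intro sum_strict_mono) (auto simp: not_le)
      also have "\<dots> = real_of_int (\<Sum>b\<in>B. N b)" by simp
      also have "\<dots> \<le> real_of_int (int h)" using bound[OF B] by (simp only: of_int_le_iff)
      finally show False using c(2) by simp
    qed
    then obtain b where b: "b \<in> B" "real_of_int (N b) \<le> c b" by blast
    have bE: "b \<in> ?E" using b(1) B(2) by blast
    note R = reflect_ok[OF bE]
    let ?q = "real h *\<^sub>R b - p"
    have q: "?q \<in> (*\<^sub>R) (real h - c b) ` (convex hull (reflect b A))"
      using reflect_dilation[OF finB b(1) _ c(1), of A] B(2) EA c(2,3) by auto
    have cb: "c b \<le> real h" using c(1,2) b(1) finB member_le_sum[of b B c] by auto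
    have "?q \<in> lattice_of (reflect b A)"
      using lattice_of_reflect[OF assms(1) zA, of b] lattice_of_superset[OF assms(1), of b] p EA bE
        lattice_of_closed(4)[of b A "int h"] by (auto intro!: lattice_of_closed(3))
    moreover have "?q \<in> cone_of (reflect b A)"
      using dilation_subset_cone[OF R(1), of "real h - c b"] q cb by auto
    moreover have "?q \<notin> exc_set t (reflect b A)" using p bE by (auto simp: mem_reflect_iff)
    ultimately have "?q \<in> pop_set t (reflect b A)" by (simp add: exc_set_def)
    moreover have "delta_max (reflect b A) (n b) / delta_min (reflect b A) (n b)
        * phi (reflect b A) t \<le> c b"
      using b(2) unfolding N_def by linarith
    ultimately have "?q \<in> hfold t h (reflect b A)"
      using hfold_of_pop_set[OF R(1-3) assms(5) R(4) assms(6)[OF bE]] cb q by blast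
    then show "p \<in> hfold t h A" using hfold_reflect_iff[OF assms(1) Eint[OF bE]] by blast
  qed
qed

end
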